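(* Let $\mathcal R$ be a tolerance relation on $X=\{1,\ldots,n\}$, $n\ge1$, and let $m\geq 1$. (1) Suppose $\mathcal R$ is connected. Then for every pair of non-negative integers $(p,q)$ with $p+q=nm$, the space $H(E(\mathcal R),m)_{p,q}$ of non-singular hermitian matrices in $M_m(E(\mathcal R))$ with signature $(p,q)$ is path-connected. (2) For general $\mathcal R$, the space $H(E(\mathcal R),m)$ has $\prod_{K\in\mathcal K}(|K|m+1)$ path-connected components, which are labeled by the tuple of matrix signatures in each summand (one summand for each $K\in\mathcal K$). Consequently, the tuple of signatures induces a bijection $$\mathcal V_0(E(\mathcal R),m)\cong\prod_{K\in\mathcal K}\{-|K|m,-|K|m+2,\ldots,|K|m\}.$$
   Context: A tolerance relation on $X$ is a reflexive and symmetric relation $\mathcal R\subseteq X\times X$; it is regarded as a graph with vertex set $X$ and edge set $\mathcal R$, and is called connected if this graph is connected. The associated graph operator system is $$E(\mathcal R)=\{(x_{ij})\in M_n(\mathbb C)\mid x_{ij}=0\text{ if }(i,j)\notin\mathcal R\}.$$ $\mathcal K$ is the set of equivalence classes in $X$ of the equivalence relation generated by $\mathcal R$ (the connected components of the graph). One has $E(\mathcal R)=\bigoplus_{K\in\mathcal K}E(\mathcal R_K)$ with $E(\mathcal R_K)\subseteq M_{|K|}(\mathbb C)$, where $\mathcal R_K$ is the restriction of $\mathcal R$ to $K$; the $C^*$-envelope of $E(\mathcal R)$ is $\bigoplus_{K\in\mathcal K}M_{|K|}(\mathbb C)$. $H(E(\mathcal R),m)$ is the space of elements $x\in M_m(E(\mathcal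 R))\subseteq M_{nm}(\mathbb C)$ that are hermitian and invertible (as matrices in $M_{nm}(\mathbb C)$, equivalently in $M_m$ of the $C^*$-envelope), with the topology inherited from $M_{nm}(\mathbb C)$. $H(E(\mathcal R),m)_{p,q}$ is the subset of matrices with $p$ positive and $q$ negative eigenvalues (signature $(p,q)$). $\mathcal V_0(E(\mathcal R),m):=\pi_0(H(E(\mathcal R),m))$. The integer label of a signature $(p,q)$ is $p-q$; for general $\mathcal R$ the label of $x$ is the tuple of signatures of its components in $M_m(E(\mathcal R_K))\subseteq M_{|K|m}(\mathbb C)$, $K\in\mathcal K$. *)

theory Defs
  imports
    "HOL-Analysis.Analysis"
    "Jordan_Normal_Form.Char_Poly"
    "Jordan_Normal_Form.DL_Submatrix"
    "Jordan_Normal_Form.Schur_Decomposition"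
begin

section \<open>Tolerance relations\<close>

definition tolerance_rel :: "'a set \<Rightarrow> ('a \<times> 'a) set \<Rightarrow> bool" where
  "tolerance_rel X R \<longleftrightarrow> R \<subseteq> X \<times> X \<and> refl_on X R \<and> sym R"

definition connected_rel :: "'a set \<Rightarrow> ('a \<times> 'a) set \<Rightarrow> bool" where
  "connected_rel X R \<longleftrightarrow> (\<forall>i\<in>X. \<forall>j\<in>X. (i, j) \<in> R\<^sup>*)"

definition generated_equiv :: "'a set \<Rightarrow> ('a \<times> 'a) set \<Rightarrow> ('a \<times> 'a) set" where
  "generated_equiv X R = \<Inter>{S. equiv X S \<and> R \<subseteq> S}"

definition rel_components :: "'a set \<Rightarrow> ('a \<times> 'a) set \<Rightarrow> 'a set set" where
  "rel_components X R = X // generated_equiv X R"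

section \<open>Graph operator systems and their matrix amplifications\<close>

text \<open>Vertices are \<open>1, \<dots>, n\<close>, whereas matrix entries are indexed from \<open>0\<close>.\<close>

definition graph_opsys :: "nat \<Rightarrow> (nat \<times> nat) set \<Rightarrow> complex mat set" where
  "graph_opsys n R =
    {x \<in> carrier_mat n n. \<forall>i\<in>{1..n}. \<forall>j\<in>{1..n}. (i, j) \<notin> R \<longrightarrow> x $$ (i - 1, j - 1) = 0}"

text \<open>
  \<open>M\<^sub>m(E)\<close> for \<open>E \<subseteq> M\<^sub>n\<close>, regarded inside \<open>M\<^bsub>nm\<^esub>\<close>: an \<open>m \<times> m\<close> array of
  \<open>n \<times> n\<close> blocks, so that entry \<open>i\<close> of block \<open>a\<close> has the index \<open>a * n + i\<close>.
\<close>

definition mat_amp :: "nat \<Rightarrow> nat \<Rightarrow> complex mat set \<Rightarrow> complex mat set" where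
  "mat_amp n m E =
    {x \<in> carrier_mat (n * m) (n * m).
      \<forall>a<m. \<forall>b<m. submatrix x {a * n..<a * n + n} {b * n..<b * n + n} \<in> E}"

text \<open>
  The summand of \<open>x \<in> M\<^sub>m(M\<^sub>n)\<close> in \<open>M\<^sub>m(M\<^bsub>|K|\<^esub>)\<close>: every block is cut down to the
  rows and columns belonging to the vertices in \<open>K\<close>. As \<^const>\<open>submatrix\<close> keeps the
  order of the indices, the result is again an \<open>m \<times> m\<close> array of \<open>|K| \<times> |K|\<close> blocks.
\<close>

definition summand :: "nat \<Rightarrow> nat \<Rightarrow> nat set \<Rightarrow> complex mat \<Rightarrow> complex mat" where
  "summand n m K x =
    (let I = {a * n + (i - 1) | a i. a < m \<and> i \<in> K} in submatrix x I I)"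

section \<open>Signatures\<close>

definition hermitian_mat :: "complex mat \<Rightarrow> bool" where
  "hermitian_mat x \<longleftrightarrow> mat_adjoint x = x"

text \<open>Eigenvalues are counted with algebraic multiplicity.\<close>

definition num_pos_eigenvalues :: "complex mat \<Rightarrow> nat" where
  "num_pos_eigenvalues x =
    (\<Sum>l\<in>{l :: real. l > 0 \<and> eigenvalue x (complex_of_real l)}.
      Polynomial.order (complex_of_real l) (char_poly x))"

definition num_neg_eigenvalues :: "complex mat \<Rightarrow> nat" where
  "num_neg_eigenvalues x =
    (\<Sum>l\<in>{l :: real. l < 0 \<and> eigenvalue x (complex_of_real l)}.
      Polynomial.order (complex_of_real l) (char_poly x))"

definition mat_signature :: "complex mat \<Rightarrow> nat \<times> nat" where
  "mat_signature x = (num_pos_eigenvalues x, num_neg_eigenvalues x)"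

definition signature_label :: "nat \<times> nat \<Rightarrow> int" where
  "signature_label s = int (fst s) - int (snd s)"

definition signature_tuple ::
    "nat \<Rightarrow> nat \<Rightarrow> (nat \<times> nat) set \<Rightarrow> complex mat \<Rightarrow> nat set \<Rightarrow> nat \<times> nat" where
  "signature_tuple n m R x =
    (\<lambda>K\<in>rel_components {1..n} R. mat_signature (summand n m K x))"

definition label_tuple ::
    "nat \<Rightarrow> nat \<Rightarrow> (nat \<times> nat) set \<Rightarrow> complex mat \<Rightarrow> nat set \<Rightarrow> int" where
  "label_tuple n m R x =
    (\<lambda>K\<in>rel_components {1..n} R. signature_label (mat_signature (summand n m K x)))"

section \<open>The spaces of invertible hermitian elements\<close>

text \<open>
  The type \<^typ>\<open>complex mat\<close> carries no topology. The usual topology of \<open>M\<^sub>N\<close> is that of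
  the finite product of the entries.
\<close>

definition mat_topology :: "nat \<Rightarrow> complex mat topology" where
  "mat_topology N =
    pullback_topology (carrier_mat N N) (\<lambda>x. \<lambda>ij\<in>{..<N} \<times> {..<N}. x $$ ij)
      (product_topology (\<lambda>_. euclidean) ({..<N} \<times> {..<N}))"

definition herm_inv :: "nat \<Rightarrow> nat \<Rightarrow> complex mat set \<Rightarrow> complex mat set" where
  "herm_inv n m E = {x \<in> mat_amp n m E. hermitian_mat x \<and> invertible_mat x}"

definition herm_inv_sig :: "nat \<Rightarrow> nat \<Rightarrow> complex mat set \<Rightarrow> nat \<Rightarrow> nat \<Rightarrow> complex mat set" where
  "herm_inv_sig n m E p q = {x \<in> herm_inv n m E. mat_signature x = (p, q)}"

definition V0 :: "nat \<Rightarrow> nat \<Rightarrow> complex mat set \<Rightarrow> complex mat set set" where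
  "V0 n m E = path_components_of (subtopology (mat_topology (n * m)) (herm_inv n m E))"

end

theory Submission
  imports Defs
begin

text \<open>
  If the rows and columns are indexed by pairs of a vertex and a block number, then
  \<open>M\<^sub>m(E(\<R>))\<close> consists of the \<open>nm \<times> nm\<close> matrices
  supported on the edges of a single graph: \<open>(i, a)\<close> and \<open>(j, b)\<close>
  are adjacent when \<open>(i, j) \<in> \<R>\<close>. As \<open>\<R>\<close> is reflexive,
  the connected components of this graph are the sets of all \<open>(i, a)\<close> with
  \<open>i\<close> in a fixed \<open>K \<in> \<K>\<close>. So the amplification can be
  forgotten, and the theorem is about invertible hermitian matrices whose support is
  contained in a given graph.

  Such a matrix can be deformed to a diagonal matrix with entries
  \<open>\<plusminus>1\<close> (\<open>joined_diag_sign\<close>): after an arbitrarily small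
  shift by a multiple of the identity the principal minor obtained by deleting a vertex
  \<open>v\<close> is nonzero, and then the off-diagonal entries of row and column
  \<open>v\<close> can be scaled to zero while the diagonal entry at \<open>v\<close> is
  adjusted so that the determinant stays constant. One vertex after the other is isolated in
  this way, and none of the zeros already produced is lost.

  Along an edge between two vertices carrying opposite signs, conjugation by a rotation turns
  \<open>diag(1, -1)\<close> into \<open>diag(-1, 1)\<close> inside the graph pattern (\<open>joined_swap_edge\<close>). Moving along
  paths of the graph, any two sign matrices with the same number of positive signs in each
  connected component are joined (\<open>joined_diag_sign_same_counts\<close>).

  Conversely, the signature of the block of each connected component cannot change along a path
  (\<open>mat_signature_constant_on_path\<close>): real eigenvalues depend continuously on the matrix, and
  none of them passes through zero. Hence two elements lie in the same path component if and
  only if their signature tuples agree, and sign matrices show that every tuple occurs.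
\<close>

section \<open>Hermitian and invertible matrices, entrywise\<close>

lemma hermitian_mat_iff:
  assumes "x \<in> carrier_mat N N"
  shows "hermitian_mat x \<longleftrightarrow> (\<forall>i<N. \<forall>j<N. cnj (x $$ (j, i)) = x $$ (i, j))"
proof -
  have dim: "dim_row x = N" "dim_col x = N"
    using assms by auto
  have entry: "mat_adjoint x $$ (i, j) = cnj (x $$ (j, i))" if "i < N" "j < N" for i j
    using that dim by (simp add: mat_adjoint_def mat_of_rows_index conjugate_complex_def)
  have "dim_row (mat_adjoint x) = N" "dim_col (mat_adjoint x) = N"
    using dim by (auto simp: mat_adjoint_def)
  then have "mat_adjoint x = x \<longleftrightarrow> (\<forall>i<N. \<forall>j<N. mat_adjoint x $$ (i, j) = x $$ (i, j))"
    using dim mat_eq_iff by metis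
  then show ?thesis
    unfolding hermitian_mat_def using entry by metis
qed

lemma invertible_mat_iff_det:
  fixes A :: "'a::field mat"
  assumes A: "A \<in> carrier_mat N N"
  shows "invertible_mat A \<longleftrightarrow> det A \<noteq> 0"
proof
  assume "invertible_mat A"
  then obtain B where "A * B = 1\<^sub>m (dim_row A)" "B * A = 1\<^sub>m (dim_row B)"
    unfolding invertible_mat_def inverts_mat_def by blast
  then have AB: "A * B = 1\<^sub>m N" and BA: "B * A = 1\<^sub>m (dim_row B)"
    using A by auto
  have "dim_col B = N"
    using arg_cong[OF AB, of dim_col] by simp
  moreover have "dim_row B = N"
    using arg_cong[OF BA, of dim_col] A by simp
  ultimately have "B \<in> carrier_mat N N"
    by auto
  then have "det A * det B = 1"
    using det_mult[OF A, of B] AB by simp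
  then show "det A \<noteq> 0"
    by auto
next
  assume "det A \<noteq> 0"
  from det_non_zero_imp_unit[OF A this, of "()"]
  obtain B where "B \<in> carrier_mat N N" "A * B = 1\<^sub>m N" "B * A = 1\<^sub>m N"
    unfolding Units_def ring_mat_simps by blast
  then show "invertible_mat A"
    unfolding invertible_mat_def inverts_mat_def using A by auto
qed

lemma det_hermitian_real:
  assumes A: "A \<in> carrier_mat N N"
    and herm: "\<And>i j. i < N \<Longrightarrow> j < N \<Longrightarrow> cnj (A $$ (j, i)) = A $$ (i, j)"
  shows "cnj (det A) = det A"
proof -
  interpret cnj: comm_ring_hom cnj
    by unfold_locales auto
  have "map_mat cnj A = transpose_mat A"
    by (rule eq_matI) (use A herm in auto)
  then show ?thesis
    using cnj.hom_det[of A] det_transpose[OF A] by simp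
qed

lemma continuous_on_det:
  assumes "\<And>t. t \<in> T \<Longrightarrow> g t \<in> carrier_mat N N"
    and "\<And>i j. i < N \<Longrightarrow> j < N \<Longrightarrow> continuous_on T (\<lambda>t. g t $$ (i, j))"
  shows "continuous_on T (\<lambda>t. det (g t :: complex mat))"
proof -
  have "continuous_on T (\<lambda>t. \<Sum>p | p permutes {0..<N}.
      signof p * (\<Prod>i = 0..<N. g t $$ (i, p i)))"
    by (intro continuous_intros assms)
      (auto dest: permutes_in_image)
  then show ?thesis
    using assms(1) by (subst continuous_on_cong[OF refl det_def'[OF assms(1)]]) auto
qed

section \<open>Paths of hermitian matrices with a prescribed sparsity pattern\<close>

definition pattern_herm :: "nat \<Rightarrow> (nat \<times> nat) set \<Rightarrow> complex mat set" where
  "pattern_herm N E = {x \<in> carrier_mat N N. hermitian_mat x \<and> invertible_mat x \<and>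
     (\<forall>i<N. \<forall>j<N. (i, j) \<notin> E \<longrightarrow> x $$ (i, j) = 0)}"

lemma pattern_herm_iff:
  "x \<in> pattern_herm N E \<longleftrightarrow> x \<in> carrier_mat N N \<and> det x \<noteq> 0 \<and>
     (\<forall>i<N. \<forall>j<N. cnj (x $$ (j, i)) = x $$ (i, j)) \<and>
     (\<forall>i<N. \<forall>j<N. (i, j) \<notin> E \<longrightarrow> x $$ (i, j) = 0)"
  unfolding pattern_herm_def mem_Collect_eq
  using hermitian_mat_iff[of x N] invertible_mat_iff_det[of x N] by metis

abbreviation joined :: "nat \<Rightarrow> complex mat set \<Rightarrow> complex mat \<Rightarrow> complex mat \<Rightarrow> bool" where
  "joined N S \<equiv> path_component_of (subtopology (mat_topology N) S)"

lemma topspace_mat_topology: "topspace (mat_topology N) = carrier_mat N N"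
  unfolding mat_topology_def topspace_pullback_topology by auto

lemma continuous_map_mat_topology:
  "continuous_map T (mat_topology N) g \<longleftrightarrow> g ` topspace T \<subseteq> carrier_mat N N \<and>
     (\<forall>i<N. \<forall>j<N. continuous_map T euclidean (\<lambda>t. g t $$ (i, j)))"
proof -
  define h where "h = (\<lambda>x :: complex mat. \<lambda>ij\<in>{..<N} \<times> {..<N}. x $$ ij)"
  define P where "P = product_topology (\<lambda>_ :: nat \<times> nat. euclidean :: complex topology) ({..<N} \<times> {..<N})"
  have M: "mat_topology N = pullback_topology (carrier_mat N N) h P"
    unfolding mat_topology_def h_def P_def ..
  have P: "continuous_map T P (h \<circ> g) \<longleftrightarrow>
     (\<forall>i<N. \<forall>j<N. continuous_map T euclidean (\<lambda>t. g t $$ (i, j)))"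
    unfolding P_def continuous_map_componentwise by (auto simp: h_def)
  show ?thesis
  proof
    assume g: "continuous_map T (mat_topology N) g"
    have "continuous_map (mat_topology N) P (id \<circ> h)"
      unfolding M by (rule continuous_map_pullback) simp
    then have "continuous_map T P (h \<circ> g)"
      using continuous_map_compose[OF g] by simp
    then show "g ` topspace T \<subseteq> carrier_mat N N \<and>
     (\<forall>i<N. \<forall>j<N. continuous_map T euclidean (\<lambda>t. g t $$ (i, j)))"
      using P continuous_map_image_subset_topspace[OF g] topspace_mat_topology by metis
  next
    assume "g ` topspace T \<subseteq> carrier_mat N N \<and>
     (\<forall>i<N. \<forall>j<N. continuous_map T euclidean (\<lambda>t. g t $$ (i, j)))"
    then show "continuous_map T (mat_topology N) g"
      unfolding M by (intro continuous_map_pullback') (use P in auto)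
  qed
qed

lemma joined_iff_path:
  assumes "S \<subseteq> carrier_mat N N"
  shows "joined N S x y \<longleftrightarrow> (\<exists>g. g 0 = x \<and> g 1 = y \<and> (\<forall>t\<in>{0..1}. g t \<in> S) \<and>
    (\<forall>i<N. \<forall>j<N. continuous_on {0..1} (\<lambda>t :: real. g t $$ (i, j))))"
  unfolding path_component_of_def pathin_def continuous_map_in_subtopology
    continuous_map_mat_topology
  using assms by (auto simp: image_subset_iff Pi_iff)

lemma joined_by_path:
  assumes "S \<subseteq> carrier_mat N N" and "\<And>t. 0 \<le> t \<Longrightarrow> t \<le> 1 \<Longrightarrow> g t \<in> S"
    and "\<And>i j. i < N \<Longrightarrow> j < N \<Longrightarrow> continuous_on {0..1} (\<lambda>t :: real. g t $$ (i, j))"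
  shows "joined N S (g 0) (g 1)"
  unfolding joined_iff_path[OF assms(1)] using assms by (intro exI[of _ g]) auto

lemma joined_refl: "S \<subseteq> carrier_mat N N \<Longrightarrow> x \<in> S \<Longrightarrow> joined N S x x"
  by (rule path_component_of_refl[THEN iffD2]) (auto simp: topspace_mat_topology)

lemma joined_sym: "joined N S x y \<Longrightarrow> joined N S y x"
  using path_component_of_sym by metis

lemma joined_in: "joined N S x y \<Longrightarrow> x \<in> S \<and> y \<in> S"
  using path_component_in_topspace by fastforce

lemma pattern_herm_carrier: "pattern_herm N E \<subseteq> carrier_mat N N"
  unfolding pattern_herm_def by auto

section \<open>Deforming to a diagonal sign matrix\<close>

definition diag_sign :: "nat \<Rightarrow> (nat \<Rightarrow> bool) \<Rightarrow> complex mat" where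
  "diag_sign N d = mat N N (\<lambda>(i, j). if i = j then if d i then 1 else -1 else 0)"

text \<open>
  Scaling row and column \<open>v\<close> by \<open>t\<close> multiplies the determinant by \<open>t\<^sup>2\<close>; the determinant is affine
  in the diagonal entry at \<open>v\<close>, with the cofactor as its slope.
\<close>

lemma det_scale_vertex:
  fixes x :: "'a::comm_ring_1 mat"
  assumes x: "x \<in> carrier_mat N N" and v: "v < N"
  shows "det (mat N N (\<lambda>(i, j). (if i = v then t else 1) * (if j = v then t else 1) * x $$ (i, j)
      + (if i = v \<and> j = v then c else 0)))
    = t\<^sup>2 * det x + c * cofactor x v v" (is "det ?M = _")
proof -
  let ?u = "\<lambda>i. if i = v then t else (1 :: 'a)"
  let ?D = "mat N N (\<lambda>(i, j). ?u i * ?u j * x $$ (i, j))"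
  have D: "?D \<in> carrier_mat N N" and M: "?M \<in> carrier_mat N N"
    by auto
  have u: "(\<Prod>i = 0..<N. ?u i) = t"
    using v by simp
  have "det ?D = t\<^sup>2 * det x"
  proof -
    have "(\<Prod>i = 0..<N. ?D $$ (i, p i)) = t\<^sup>2 * (\<Prod>i = 0..<N. x $$ (i, p i))"
      if p: "p permutes {0..<N}" for p
    proof -
      have "(\<Prod>i = 0..<N. ?D $$ (i, p i)) = (\<Prod>i = 0..<N. ?u i * ?u (p i) * x $$ (i, p i))"
        using p by (intro prod.cong) (auto dest: permutes_in_image)
      also have "\<dots> = (\<Prod>i = 0..<N. ?u i) * (\<Prod>i = 0..<N. ?u (p i)) * (\<Prod>i = 0..<N. x $$ (i, p i))"
        by (simp only: prod.distrib)
      also have "(\<Prod>i = 0..<N. ?u (p i)) = (\<Prod>i = 0..<N. ?u i)"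
        using prod.permute[OF p, of ?u] by (simp add: o_def)
      finally show ?thesis
        unfolding u by (simp add: power2_eq_square)
    qed
    then show ?thesis
      unfolding det_def'[OF D] det_def'[OF x] sum_distrib_left
      by (intro sum.cong) (auto simp: algebra_simps)
  qed
  moreover have "det ?M = det ?D + c * cofactor x v v"
  proof -
    \<comment> \<open>The two matrices differ only at \<open>(v, v)\<close>, so the expansions along row \<open>v\<close> share their cofactors.\<close>
    have "mat_delete ?M v j = mat_delete ?D v j" for j
      by (rule eq_matI) (auto simp: mat_delete_def)
    then have cof: "cofactor ?M v j = cofactor ?D v j" for j
      by (simp add: cofactor_def)
    have "mat_delete ?D v v = mat_delete x v v"
      by (rule eq_matI) (use x in \<open>auto simp: mat_delete_def\<close>)
    then have "cofactor ?D v v = cofactor x v v"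
      by (simp add: cofactor_def)
    moreover have "det ?M = (\<Sum>j<N. ?D $$ (v, j) * cofactor ?D v j + (if j = v then c * cofactor ?D v v else 0))"
      unfolding laplace_expansion_row[OF M v]
      by (intro sum.cong refl) (use v cof in \<open>auto simp: algebra_simps\<close>)
    ultimately show ?thesis
      unfolding laplace_expansion_row[OF D v] sum.distrib using v by simp
  qed
  ultimately show ?thesis
    by simp
qed

lemma det_shift:
  fixes A :: "complex mat"
  assumes A: "A \<in> carrier_mat N N"
  shows "det (mat N N (\<lambda>(i, j). A $$ (i, j) + (if i = j then c else 0))) = poly (char_poly (- A)) c"
  unfolding char_poly_def
  by (rule poly_det_cong[symmetric, of _ N])
    (use A in \<open>auto simp: char_poly_matrix_def\<close>)

lemma poly_nonzero_right_of_0: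
  fixes p :: "complex poly"
  assumes "p \<noteq> 0"
  shows "\<exists>\<epsilon>>0. \<forall>t. 0 < t \<and> t \<le> \<epsilon> \<longrightarrow> poly p (complex_of_real t) \<noteq> 0"
proof -
  let ?Z = "{z. poly p z = 0}"
  define \<epsilon> where "\<epsilon> = Min (insert 1 (norm ` ?Z - {0})) / 2"
  have fin: "finite (insert 1 (norm ` ?Z - {0}))"
    using poly_roots_finite[OF assms] by auto
  have "Min (insert 1 (norm ` ?Z - {0})) > 0"
    using Min_gr_iff[OF fin, of 0] by auto
  then have "\<epsilon> > 0"
    by (simp add: \<epsilon>_def)
  moreover have "poly p (complex_of_real t) \<noteq> 0" if "0 < t" "t \<le> \<epsilon>" for t
  proof
    assume "poly p (complex_of_real t) = 0"
    then have "t \<in> insert 1 (norm ` ?Z - {0})"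
      using that by (auto intro!: image_eqI[of _ _ "complex_of_real t"])
    then have "Min (insert 1 (norm ` ?Z - {0})) \<le> t"
      using fin by (rule Min_le[rotated])
    then show False
      using that \<open>\<epsilon> > 0\<close> unfolding \<epsilon>_def by linarith
  qed
  ultimately show ?thesis
    by blast
qed

text \<open>
  The determinant of \<open>x + c \<cdot> 1\<close> and its minor at \<open>v\<close> are, as functions of \<open>c\<close>, the characteristic
  polynomials of \<open>-x\<close> and of \<open>-x\<close> without row and column \<open>v\<close>. Nonzero polynomials have no zeros on a small
  interval to the right of \<open>0\<close>, so moving into this interval makes the minor nonzero and never leaves
  the invertible matrices.
  The shift touches the diagonal only, which preserves all off-diagonal zeros.
\<close>

lemma joined_nonzero_cofactor:
  assumes x: "x \<in> pattern_herm N E" and refl: "\<And>i. i < N \<Longrightarrow> (i, i) \<in> E" and v: "v < N"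
  shows "\<exists>y. joined N (pattern_herm N E) x y \<and> cofactor y v v \<noteq> 0 \<and>
    (\<forall>i<N. \<forall>j<N. i \<noteq> j \<longrightarrow> y $$ (i, j) = x $$ (i, j))"
proof -
  let ?S = "\<lambda>t. mat N N (\<lambda>(i, j). x $$ (i, j) + (if i = j then complex_of_real t else 0))"
  let ?p = "char_poly (- x)" and ?q = "char_poly (- mat_delete x v v)"
  have xc: "x \<in> carrier_mat N N"
    using x by (simp add: pattern_herm_iff)
  have xd: "mat_delete x v v \<in> carrier_mat (N - 1) (N - 1)"
    using mat_delete_carrier[OF xc] .
  have "monic ?p" "monic ?q"
    using degree_monic_char_poly[of "- x" N] xc
      degree_monic_char_poly[of "- mat_delete x v v" "N - 1"] xd by auto
  then have "?p \<noteq> 0" "?q \<noteq> 0"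
    by auto
  then obtain \<epsilon> \<delta> where "\<epsilon> > 0" and \<epsilon>: "\<And>t. 0 < t \<Longrightarrow> t \<le> \<epsilon> \<Longrightarrow> poly ?p (complex_of_real t) \<noteq> 0"
    and "\<delta> > 0" and \<delta>: "\<And>t. 0 < t \<Longrightarrow> t \<le> \<delta> \<Longrightarrow> poly ?q (complex_of_real t) \<noteq> 0"
    using poly_nonzero_right_of_0 by metis
  define e where "e = min \<epsilon> \<delta>"
  have e: "e > 0" "e \<le> \<epsilon>" "e \<le> \<delta>"
    using \<open>\<epsilon> > 0\<close> \<open>\<delta> > 0\<close> by (auto simp: e_def)
  have S0: "?S 0 = x"
    by (rule eq_matI) (use xc in auto)
  have S: "?S (t * e) \<in> pattern_herm N E" if "0 \<le> t" "t \<le> 1" for t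
  proof (cases "t = 0")
    case True
    then show ?thesis
      using S0 x by (simp only: mult_zero_left)
  next
    case False
    then have "0 < t * e"
      using that e by simp
    moreover have "t * e \<le> \<epsilon>"
      using that e mult_left_le_one_le[of e t] by linarith
    ultimately have "det (?S (t * e)) \<noteq> 0"
      using \<epsilon>[of "t * e"] det_shift[OF xc, of "complex_of_real (t * e)"] by metis
    then show ?thesis
      using x refl unfolding pattern_herm_iff by auto
  qed
  have "joined N (pattern_herm N E) (?S (0 * e)) (?S (1 * e))"
  proof (rule joined_by_path[OF pattern_herm_carrier S])
    fix i j assume "i < N" "j < N"
    then show "continuous_on {0..1} (\<lambda>t. ?S (t * e) $$ (i, j))"
      by (cases "i = j") (auto intro!: continuous_intros)
  qed
  then have "joined N (pattern_herm N E) x (?S e)"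
    using S0 by (simp only: mult_zero_left mult_1)
  moreover have "cofactor (?S e) v v \<noteq> 0"
  proof -
    have "mat_delete (?S e) v v = mat (N - 1) (N - 1) (\<lambda>(i, j). mat_delete x v v $$ (i, j)
        + (if i = j then complex_of_real e else 0))"
      by (rule eq_matI) (use xc in \<open>auto simp: mat_delete_def\<close>)
    then have "det (mat_delete (?S e) v v) = poly ?q (complex_of_real e)"
      using det_shift[OF xd] by simp
    then show ?thesis
      using \<delta>[of e] e by (simp add: cofactor_def)
  qed
  ultimately show ?thesis
    by (intro exI[of _ "?S e"]) auto
qed

text \<open>
  The off-diagonal entries of row and column \<open>v\<close> are multiplied by \<open>t\<close>, with \<open>t\<close> running from \<open>1\<close> to
  \<open>0\<close>. Adding \<open>(1 - t\<^sup>2) s\<close> to the scaled diagonal entry, where \<open>s = det x / cofactor x v v\<close> is the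
  Schur complement of the minor, keeps the determinant equal to
  \<open>t\<^sup>2 det x + (1 - t\<^sup>2) det x = det x\<close>. The number \<open>s\<close> is real because determinants of
  hermitian matrices are real, so the path consists of hermitian matrices.
\<close>

lemma joined_isolated_vertex:
  assumes x: "x \<in> pattern_herm N E" and refl: "\<And>i. i < N \<Longrightarrow> (i, i) \<in> E" and v: "v < N"
    and cof: "cofactor x v v \<noteq> 0"
  shows "\<exists>y. joined N (pattern_herm N E) x y \<and>
    (\<forall>i<N. \<forall>j<N. i \<noteq> j \<longrightarrow> y $$ (i, j) = (if i = v \<or> j = v then 0 else x $$ (i, j)))"
proof -
  define s where "s = det x / cofactor x v v"
  let ?t = "complex_of_real"
  let ?M = "\<lambda>t. mat N N (\<lambda>(i, j). (if i = v then ?t t else 1) * (if j = v then ?t t else 1) * x $$ (i, j)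
      + (if i = v \<and> j = v then (1 - (?t t)\<^sup>2) * s else 0))"
  have xc: "x \<in> carrier_mat N N" and dx: "det x \<noteq> 0"
    and herm: "\<And>i j. i < N \<Longrightarrow> j < N \<Longrightarrow> cnj (x $$ (j, i)) = x $$ (i, j)"
    using x by (auto simp: pattern_herm_iff)
  have xd: "mat_delete x v v \<in> carrier_mat (N - 1) (N - 1)"
    using mat_delete_carrier[OF xc] .
  have "cnj (det x) = det x"
    using det_hermitian_real[OF xc herm] .
  moreover have "cnj (det (mat_delete x v v)) = det (mat_delete x v v)"
    by (rule det_hermitian_real[OF xd]) (use xc in \<open>auto simp: mat_delete_def intro!: herm\<close>)
  ultimately have s: "cnj s = s"
    by (simp add: s_def cofactor_def)
  have detM: "det (?M t) = det x" for t
    unfolding det_scale_vertex[OF xc v] using cof by (simp add: s_def algebra_simps)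
  have "joined N (pattern_herm N E) (?M 1) (?M 0)"
  proof (rule joined_sym, rule joined_by_path[OF pattern_herm_carrier])
    fix t :: real
    show "?M t \<in> pattern_herm N E"
      unfolding pattern_herm_iff detM using dx s refl herm x
      by (auto simp: pattern_herm_iff complex_cnj_mult)
  next
    fix i j assume "i < N" "j < N"
    then show "continuous_on {0..1} (\<lambda>t. ?M t $$ (i, j))"
      by (cases "i = v"; cases "j = v") (auto intro!: continuous_intros)
  qed
  moreover have "?M 1 = x"
    by (rule eq_matI) (use xc in auto)
  ultimately show ?thesis
    by (intro exI[of _ "?M 0"]) auto
qed

text \<open>
  The vertices are isolated one by one. Both steps of a round keep off-diagonal zeros, so the vertices
  treated earlier remain isolated.
\<close>

lemma joined_diagonal:
  assumes x: "x \<in> pattern_herm N E" and refl: "\<And>i. i < N \<Longrightarrow> (i, i) \<in> E"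
  shows "\<exists>y. joined N (pattern_herm N E) x y \<and> (\<forall>i<N. \<forall>j<N. i \<noteq> j \<longrightarrow> y $$ (i, j) = 0)"
proof -
  have "\<exists>y. joined N (pattern_herm N E) x y \<and>
      (\<forall>i<N. \<forall>j<N. i \<noteq> j \<and> (i < k \<or> j < k) \<longrightarrow> y $$ (i, j) = 0)" if "k \<le> N" for k
    using that
  proof (induction k)
    case 0
    then show ?case
      using joined_refl[OF pattern_herm_carrier x] by auto
  next
    case (Suc k)
    then obtain y where y: "joined N (pattern_herm N E) x y"
      "\<And>i j. i < N \<Longrightarrow> j < N \<Longrightarrow> i \<noteq> j \<Longrightarrow> i < k \<or> j < k \<Longrightarrow> y $$ (i, j) = 0"
      by auto
    have k: "k < N"
      using Suc.prems by simp
    obtain z where z: "joined N (pattern_herm N E) y z" "cofactor z k k \<noteq> 0"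
      "\<And>i j. i < N \<Longrightarrow> j < N \<Longrightarrow> i \<noteq> j \<Longrightarrow> z $$ (i, j) = y $$ (i, j)"
      using joined_nonzero_cofactor[OF _ refl k] joined_in[OF y(1)] by blast
    obtain w where w: "joined N (pattern_herm N E) z w"
      "\<And>i j. i < N \<Longrightarrow> j < N \<Longrightarrow> i \<noteq> j \<Longrightarrow>
         w $$ (i, j) = (if i = k \<or> j = k then 0 else z $$ (i, j))"
      using joined_isolated_vertex[OF _ refl k z(2)] joined_in[OF z(1)] by blast
    have "joined N (pattern_herm N E) x w"
      using y(1) z(1) w(1) path_component_of_trans by metis
    then show ?case
      using y(2) z(3) w(2) by (intro exI[of _ w]) (auto simp: less_Suc_eq)
  qed
  from this[of N] show ?thesis
    by auto
qed

lemma det_diagonal: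
  assumes "x \<in> carrier_mat N N" "\<forall>i<N. \<forall>j<N. i \<noteq> j \<longrightarrow> x $$ (i, j) = 0"
  shows "det x = (\<Prod>i<N. x $$ (i, i) :: 'a :: idom)"
proof -
  have "upper_triangular x"
    using assms by (auto simp: upper_triangular_def)
  then show ?thesis
    using assms(1) det_upper_triangular[OF _ assms(1)]
    by (simp add: diag_mat_def prod.list_conv_set_nth atLeast0LessThan)
qed

lemma diag_sign_in:
  assumes "\<And>i. i < N \<Longrightarrow> (i, i) \<in> E"
  shows "diag_sign N d \<in> pattern_herm N E"
proof -
  have "det (diag_sign N d) = (\<Prod>i<N. diag_sign N d $$ (i, i))"
    by (rule det_diagonal) (auto simp: diag_sign_def)
  also have "\<dots> \<noteq> 0"
    by (auto simp: diag_sign_def)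
  finally show ?thesis
    unfolding pattern_herm_iff using assms by (auto simp: diag_sign_def)
qed

lemma joined_diag_sign:
  assumes x: "x \<in> pattern_herm N E" and refl: "\<And>i. i < N \<Longrightarrow> (i, i) \<in> E"
  shows "\<exists>d. joined N (pattern_herm N E) x (diag_sign N d)"
proof -
  obtain y where y: "joined N (pattern_herm N E) x y"
    and off: "\<forall>i<N. \<forall>j<N. i \<noteq> j \<longrightarrow> y $$ (i, j) = 0"
    using joined_diagonal[OF assms] by blast
  have yP: "y \<in> pattern_herm N E"
    using joined_in[OF y] by blast
  then have yc: "y \<in> carrier_mat N N" and dy: "det y \<noteq> 0"
    and herm: "\<And>i j. i < N \<Longrightarrow> j < N \<Longrightarrow> cnj (y $$ (j, i)) = y $$ (i, j)"
    by (auto simp: pattern_herm_iff)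
  define r where "r i = Re (y $$ (i, i))" for i
  have r: "y $$ (i, i) = complex_of_real (r i)" if "i < N" for i
    using herm[OF that that] unfolding r_def by (simp add: complex_eq_iff)
  have r0: "r i \<noteq> 0" if "i < N" for i
    using dy det_diagonal[OF yc off] r that by auto
  let ?M = "\<lambda>t. mat N N (\<lambda>(i, j). if i = j then complex_of_real ((1 - t) * r i + t * sgn (r i)) else 0)"
  have "joined N (pattern_herm N E) (?M 0) (?M 1)"
  proof (rule joined_by_path[OF pattern_herm_carrier])
    fix t :: real
    assume t: "0 \<le> t" "t \<le> 1"
    have "(1 - t) * r i + t * sgn (r i) \<noteq> 0" if "i < N" for i
    proof -
      have "(1 - t) * r i + t * sgn (r i) = sgn (r i) * ((1 - t) * \<bar>r i\<bar> + t)"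
        by (simp add: algebra_simps abs_sgn sgn_if)
      moreover have "(1 - t) * \<bar>r i\<bar> + t > 0"
        using t r0[OF that] by (cases "t = 0") (auto intro: add_nonneg_pos)
      ultimately show ?thesis
        using r0[OF that] by (simp add: sgn_eq_0_iff)
    qed
    then have "(\<Prod>i<N. ?M t $$ (i, i)) \<noteq> 0"
      by (auto simp flip: of_real_mult of_real_add)
    then have "det (?M t) \<noteq> 0"
      by (subst det_diagonal) auto
    then show "?M t \<in> pattern_herm N E"
      unfolding pattern_herm_iff using refl by auto
  next
    fix i j assume "i < N" "j < N"
    then show "continuous_on {0..1} (\<lambda>t. ?M t $$ (i, j))"
      by (cases "i = j") (auto intro!: continuous_intros)
  qed
  moreover have "?M 0 = y"
    by (rule eq_matI) (use yc off r in auto)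
  moreover have "?M 1 = diag_sign N (\<lambda>i. r i > 0)"
    by (rule eq_matI) (use r0 in \<open>auto simp: diag_sign_def sgn_if\<close>)
  ultimately show ?thesis
    using y path_component_of_trans by metis
qed

section \<open>Exchanging signs along a path of the graph\<close>

lemma sum_two_points:
  fixes f :: "'a \<Rightarrow> 'b::comm_semiring_1"
  assumes "finite A" "v \<in> A" "w \<in> A" "v \<noteq> w"
  shows "(\<Sum>k\<in>A. (if k = v then a else if k = w then b else 0) * f k) = a * f v + b * f w"
proof -
  have "(\<Sum>k\<in>A. (if k = v then a else if k = w then b else 0) * f k)
      = (\<Sum>k\<in>A. (if k = v then a * f k else 0) + (if k = w then b * f k else 0))"
    using assms by (intro sum.cong) auto
  then show ?thesis
    using assms by (simp add: sum.distrib)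
qed

text \<open>
  If the two signs differ, the block \<open>\<plusminus>diag(1, -1)\<close> on the edge is moved through the reflections with
  rows \<open>(\<plusminus>cos \<theta>, sin \<theta>)\<close> and \<open>(sin \<theta>, \<mp>cos \<theta>)\<close>, for \<open>\<theta>\<close> from \<open>0\<close> to \<open>\<pi>\<close>. Every matrix on this
  path is an involution and therefore invertible.
\<close>

lemma joined_swap_edge:
  assumes refl: "\<And>i. i < N \<Longrightarrow> (i, i) \<in> E" and vw: "(v, w) \<in> E" "(w, v) \<in> E" "v < N" "w < N" "v \<noteq> w"
  shows "joined N (pattern_herm N E) (diag_sign N d) (diag_sign N (d \<circ> Transposition.transpose v w))"
proof (cases "d v = d w")
  case True
  then have "d \<circ> Transposition.transpose v w = d"
    by (auto simp: fun_eq_iff Transposition.transpose_def)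
  then show ?thesis
    using joined_refl[OF pattern_herm_carrier diag_sign_in[OF refl]] by simp
next
  case False
  define \<alpha> where "\<alpha> t = complex_of_real ((if d v then 1 else -1) * cos (pi * t))" for t
  define \<beta> where "\<beta> t = complex_of_real (sin (pi * t))" for t
  have \<alpha>\<beta>: "\<alpha> t * \<alpha> t + \<beta> t * \<beta> t = 1" for t
    using sin_cos_squared_add[of "pi * t"]
    by (simp add: \<alpha>_def \<beta>_def power2_eq_square flip: of_real_mult of_real_add)
  have real: "cnj (\<alpha> t) = \<alpha> t" "cnj (\<beta> t) = \<beta> t" for t
    by (simp_all add: \<alpha>_def \<beta>_def)
  have cont: "continuous_on S \<alpha>" "continuous_on S \<beta>" for S
    unfolding \<alpha>_def[abs_def] \<beta>_def[abs_def] by (intro continuous_intros)+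
  define F :: "real \<Rightarrow> nat \<Rightarrow> nat \<Rightarrow> complex" where
    "F t i j = (if i = v then if j = v then \<alpha> t else if j = w then \<beta> t else 0
      else if i = w then if j = v then \<beta> t else if j = w then - \<alpha> t else 0
      else if j = i then if d i then 1 else -1 else 0)" for t i j
  define M where "M t = mat N N (\<lambda>(i, j). F t i j)" for t
  have "joined N (pattern_herm N E) (M 0) (M 1)"
  proof (rule joined_by_path[OF pattern_herm_carrier])
    fix t :: real
    have F: "(\<Sum>k\<in>{0..<N}. F t i k * F t k j) = (if i = j then 1 else 0)" if "i < N" "j < N" for i j
    proof -
      consider "i = v" | "i = w" | "i \<noteq> v" "i \<noteq> w"
        by blast
      then show ?thesis
      proof cases
        case 1
        then have "F t i k = (if k = v then \<alpha> t else if k = w then \<beta> t else 0)" for k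
          by (simp add: F_def)
        then show ?thesis
          using vw 1 \<alpha>\<beta>[of t] by (simp add: sum_two_points) (auto simp: F_def algebra_simps)
      next
        case 2
        then have "F t i k = (if k = v then \<beta> t else if k = w then - \<alpha> t else 0)" for k
          using vw by (simp add: F_def)
        then show ?thesis
          using vw 2 \<alpha>\<beta>[of t] by (simp add: sum_two_points) (auto simp: F_def algebra_simps)
      next
        case 3
        then have "F t i k * F t k j = (if k = i then (if d i then 1 else -1) * F t i j else 0)" for k
          by (simp add: F_def)
        then show ?thesis
          using that 3 by (auto simp: F_def)
      qed
    qed
    have "M t * M t = 1\<^sub>m N"
      by (rule eq_matI) (auto simp: M_def scalar_prod_def F)
    then have "det (M t) * det (M t) = 1"
      using det_mult[of "M t" N "M t"] by (simp add: M_def)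
    then have "det (M t) \<noteq> 0"
      by auto
    then show "M t \<in> pattern_herm N E"
      unfolding pattern_herm_iff using refl vw real by (auto simp: M_def F_def)
  next
    fix i j assume "i < N" "j < N"
    then show "continuous_on {0..1} (\<lambda>t. M t $$ (i, j))"
      by (cases "i = v"; cases "i = w"; cases "j = v"; cases "j = w")
        (auto simp: M_def F_def intro!: cont continuous_intros)
  qed
  moreover have "M 0 = diag_sign N d"
    by (rule eq_matI) (use False vw in \<open>auto simp: M_def F_def \<alpha>_def \<beta>_def diag_sign_def\<close>)
  moreover have "M 1 = diag_sign N (d \<circ> Transposition.transpose v w)"
    by (rule eq_matI)
      (use False vw in \<open>auto simp: M_def F_def \<alpha>_def \<beta>_def diag_sign_def Transposition.transpose_def\<close>)
  ultimately show ?thesis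
    by simp
qed

text \<open>
  The transposition of the ends of a walk is conjugate to that of its last edge:
  \<open>(v w) = (v u)(u w)(v u)\<close>.
\<close>

lemma joined_swap:
  assumes refl: "\<And>i. i < N \<Longrightarrow> (i, i) \<in> E" and sym: "sym E" and sub: "E \<subseteq> {..<N} \<times> {..<N}"
    and "(v, w) \<in> E\<^sup>*" and v: "v < N"
  shows "joined N (pattern_herm N E) (diag_sign N d) (diag_sign N (d \<circ> Transposition.transpose v w))"
  using \<open>(v, w) \<in> E\<^sup>*\<close>
proof (induction arbitrary: d rule: rtrancl_induct)
  case base
  then show ?case
    using joined_refl[OF pattern_herm_carrier diag_sign_in[OF refl]] by simp
next
  case (step u w)
  have uw: "(w, u) \<in> E" "u < N" "w < N"
    using step.hyps(2) sym sub by (auto dest: symD)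
  show ?case
  proof (cases "u = w \<or> v = w")
    case True
    then show ?thesis
      using step.IH joined_refl[OF pattern_herm_carrier diag_sign_in[OF refl]] by auto
  next
    case False
    let ?vu = "Transposition.transpose v u" and ?uw = "Transposition.transpose u w"
    have edge: "joined N (pattern_herm N E) (diag_sign N d) (diag_sign N (d \<circ> ?uw))" for d
      using joined_swap_edge[OF refl step.hyps(2) uw] False by blast
    show ?thesis
    proof (cases "v = u")
      case True
      then show ?thesis
        using edge[of d] by (simp only: True)
    next
      case False': False
      have "joined N (pattern_herm N E) (diag_sign N d) (diag_sign N (d \<circ> ?vu \<circ> ?uw \<circ> ?vu))"
        by (rule path_component_of_trans[OF path_component_of_trans[OF step.IH edge] step.IH])
      moreover have "?vu \<circ> ?uw \<circ> ?vu = Transposition.transpose v w"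
        using False False' by (auto simp: fun_eq_iff Transposition.transpose_def)
      ultimately show ?thesis
        by (simp only: comp_assoc)
    qed
  qed
qed

lemma card_transpose_invariant:
  assumes "v \<in> A \<longleftrightarrow> w \<in> A"
  shows "card {j \<in> A. (d \<circ> Transposition.transpose v w) j} = card {j \<in> A. d j}"
proof -
  have "Transposition.transpose v w j \<in> A \<longleftrightarrow> j \<in> A" for j
    using assms by (cases "j = v"; cases "j = w") simp_all
  then have "{j \<in> A. (d \<circ> Transposition.transpose v w) j} = Transposition.transpose v w ` {j \<in> A. d j}"
    by (simp add: set_eq_iff in_transpose_image_iff)
  then show ?thesis
    using card_image[OF inj_on_transpose] by metis
qed

text \<open>
  If the signs differ somewhere, the equal counts provide in the same connected component a second place
  where they differ in the opposite direction. Exchanging the two signs removes both differences.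
\<close>

lemma joined_diag_sign_same_counts:
  assumes refl: "\<And>i. i < N \<Longrightarrow> (i, i) \<in> E" and sym: "sym E" and sub: "E \<subseteq> {..<N} \<times> {..<N}"
    and "\<And>v. v < N \<Longrightarrow> card {j \<in> {j. j < N \<and> (v, j) \<in> E\<^sup>*}. d j} = card {j \<in> {j. j < N \<and> (v, j) \<in> E\<^sup>*}. d' j}"
  shows "joined N (pattern_herm N E) (diag_sign N d) (diag_sign N d')"
  using assms(4)
proof (induction "card {i. i < N \<and> d i \<noteq> d' i}" arbitrary: d rule: less_induct)
  case less
  let ?K = "\<lambda>v. {j. j < N \<and> (v, j) \<in> E\<^sup>*}"
  show ?case
  proof (cases "\<exists>v<N. d v \<noteq> d' v")
    case False
    then have "diag_sign N d = diag_sign N d'"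
      by (auto simp: diag_sign_def intro!: eq_matI)
    then show ?thesis
      using joined_refl[OF pattern_herm_carrier diag_sign_in[OF refl]] by simp
  next
    case True
    then obtain v where v: "v < N" "d v \<noteq> d' v"
      by blast
    have "\<exists>w \<in> ?K v. d w \<noteq> d v \<and> d' w = d v"
    proof (rule ccontr)
      assume no: "\<not> ?thesis"
      have fin: "finite {j \<in> ?K v. d j}" "finite {j \<in> ?K v. d' j}"
        by auto
      have vK: "v \<in> ?K v"
        using v by simp
      have no': "d w = d v \<or> d' w \<noteq> d v" if "w \<in> ?K v" for w
        using no that by blast
      show False
      proof (cases "d v")
        case True
        then have "{j \<in> ?K v. d' j} \<subseteq> {j \<in> ?K v. d j}"
          using no' by auto
        moreover have "v \<in> {j \<in> ?K v. d j} - {j \<in> ?K v. d' j}"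
          using vK v(2) True by simp
        ultimately have "card {j \<in> ?K v. d' j} < card {j \<in> ?K v. d j}"
          by (intro psubset_card_mono[OF fin(1)]) blast
        then show False
          using less.prems[OF v(1)] by linarith
      next
        case False
        then have "{j \<in> ?K v. d j} \<subseteq> {j \<in> ?K v. d' j}"
          using no' by auto
        moreover have "v \<in> {j \<in> ?K v. d' j} - {j \<in> ?K v. d j}"
          using vK v(2) False by simp
        ultimately have "card {j \<in> ?K v. d j} < card {j \<in> ?K v. d' j}"
          by (intro psubset_card_mono[OF fin(2)]) blast
        then show False
          using less.prems[OF v(1)] by linarith
      qed
    qed
    then obtain w where w: "w < N" "(v, w) \<in> E\<^sup>*" "d w \<noteq> d v" "d' w = d v"
      by blast
    have wv: "(w, v) \<in> E\<^sup>*"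
      using w(2) sym by (meson symD sym_rtrancl)
    let ?d = "d \<circ> Transposition.transpose v w"
    have "joined N (pattern_herm N E) (diag_sign N d) (diag_sign N ?d)"
      using joined_swap[OF refl sym sub w(2) v(1)] .
    moreover have "joined N (pattern_herm N E) (diag_sign N ?d) (diag_sign N d')"
    proof (rule less.hyps)
      have "{i. i < N \<and> ?d i \<noteq> d' i} \<subseteq> {i. i < N \<and> d i \<noteq> d' i}"
        using v w by (auto simp: Transposition.transpose_def)
      moreover have "v \<in> {i. i < N \<and> d i \<noteq> d' i} - {i. i < N \<and> ?d i \<noteq> d' i}"
        using v w by auto
      ultimately show "card {i. i < N \<and> ?d i \<noteq> d' i} < card {i. i < N \<and> d i \<noteq> d' i}"
        by (intro psubset_card_mono) (simp, blast)
    next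
      fix u assume "u < N"
      have "v \<in> ?K u \<longleftrightarrow> w \<in> ?K u"
        using v(1) w(1,2) wv by (auto intro: rtrancl_trans)
      then have "card {j \<in> ?K u. ?d j} = card {j \<in> ?K u. d j}"
        by (rule card_transpose_invariant)
      then show "card {j \<in> ?K u. ?d j} = card {j \<in> ?K u. d' j}"
        using less.prems[OF \<open>u < N\<close>] by (rule trans)
    qed
    ultimately show ?thesis
      by (rule path_component_of_trans)
  qed
qed

section \<open>The signature does not change along a path\<close>

lemma order_prod_linear:
  fixes a :: "'i \<Rightarrow> 'a::idom"
  assumes "finite I"
  shows "Polynomial.order c (\<Prod>i\<in>I. [:- a i, 1:]) = card {i \<in> I. a i = c}"
  using assms
proof (induction I)
  case empty
  then show ?case
    by (simp add: order_0I)
next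
  case (insert j I)
  have "Polynomial.order c [:- a j, 1:] = (if a j = c then 1 else 0)"
    using order_power_n_n[of c 1] by (auto intro: order_0I)
  moreover have "(\<Prod>i\<in>insert j I. [:- a i, 1:]) \<noteq> 0"
    using insert.hyps(1) by auto
  moreover have "{i \<in> insert j I. a i = c} = (if a j = c then insert j {i \<in> I. a i = c} else {i \<in> I. a i = c})"
    by auto
  ultimately show ?case
    using insert by (simp add: order_mult del: mult_pCons_left)
qed

text \<open>
  The sum groups the linear factors of the characteristic polynomial by their roots.
\<close>

lemma num_eigenvalues_char_poly:
  assumes A: "A \<in> carrier_mat N N"
    and char: "char_poly A = (\<Prod>i<N. [:- complex_of_real (l i), 1:])"
  shows "(\<Sum>r\<in>{r :: real. P r \<and> eigenvalue A (complex_of_real r)}.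
      Polynomial.order (complex_of_real r) (char_poly A)) = card {i. i < N \<and> P (l i)}"
proof -
  have "eigenvalue A (complex_of_real r) \<longleftrightarrow> r \<in> l ` {..<N}" for r
    unfolding eigenvalue_root_char_poly[OF A] char by (auto simp: poly_prod)
  then have ev: "{r :: real. P r \<and> eigenvalue A (complex_of_real r)} = l ` {i. i < N \<and> P (l i)}"
    by auto
  have "card {i. i < N \<and> P (l i)} = (\<Sum>r\<in>l ` {i. i < N \<and> P (l i)}. card {i \<in> {i. i < N \<and> P (l i)}. l i = r})"
    using sum.group[of "{i. i < N \<and> P (l i)}" "l ` {i. i < N \<and> P (l i)}" l "\<lambda>_. 1 :: nat"] by simp
  also have "\<dots> = (\<Sum>r\<in>l ` {i. i < N \<and> P (l i)}. Polynomial.order (complex_of_real r) (char_poly A))"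
    unfolding char order_prod_linear[OF finite_lessThan]
    by (intro sum.cong refl arg_cong[of _ _ card]) auto
  finally show ?thesis
    unfolding ev ..
qed

lemma mat_signature_char_poly:
  assumes "A \<in> carrier_mat N N"
    and "char_poly A = (\<Prod>i<N. [:- complex_of_real (l i), 1:])"
  shows "mat_signature A = (card {i. i < N \<and> l i > 0}, card {i. i < N \<and> l i < 0})"
  unfolding mat_signature_def num_pos_eigenvalues_def num_neg_eigenvalues_def
  using num_eigenvalues_char_poly[OF assms] by simp

lemma hermitian_eigenvalue_real:
  assumes A: "A \<in> carrier_mat N N"
    and herm: "\<And>i j. i < N \<Longrightarrow> j < N \<Longrightarrow> cnj (A $$ (j, i)) = A $$ (i, j)"
    and "eigenvalue A k"
  shows "cnj k = k"
proof -
  obtain u where u: "u \<in> carrier_vec N" "u \<noteq> 0\<^sub>v N" "A *\<^sub>v u = k \<cdot>\<^sub>v u"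
    using assms unfolding eigenvalue_def eigenvector_def by auto
  have Au: "(\<Sum>j<N. A $$ (i, j) * u $ j) = k * u $ i" if "i < N" for i
    using arg_cong[OF u(3), of "\<lambda>w. w $ i"] that A u(1)
    by (simp add: scalar_prod_def atLeast0LessThan)
  define n where "n = (\<Sum>i<N. cnj (u $ i) * u $ i)"
  define q where "q = (\<Sum>i<N. \<Sum>j<N. cnj (u $ i) * A $$ (i, j) * u $ j)"
  have "q = (\<Sum>i<N. cnj (u $ i) * (\<Sum>j<N. A $$ (i, j) * u $ j))"
    by (simp add: q_def sum_distrib_left mult.assoc)
  also have "\<dots> = (\<Sum>i<N. k * (cnj (u $ i) * u $ i))"
    by (intro sum.cong refl) (simp add: Au)
  also have "\<dots> = k * n"
    by (simp add: n_def sum_distrib_left)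
  finally have q: "q = k * n" .
  have "cnj q = (\<Sum>i<N. \<Sum>j<N. cnj (u $ j) * A $$ (j, i) * u $ i)"
    unfolding q_def cnj_sum complex_cnj_mult complex_cnj_cnj
    by (intro sum.cong refl) (simp add: herm mult_ac)
  also have "\<dots> = q"
    unfolding q_def by (rule sum.swap)
  finally have cq: "cnj q = q" .
  have n: "n = complex_of_real (\<Sum>i<N. (cmod (u $ i))\<^sup>2)"
    unfolding n_def of_real_sum by (intro sum.cong refl) (simp only: complex_norm_square mult.commute)
  obtain i where "i < N" "u $ i \<noteq> 0"
    using u(1,2) by (metis carrier_vecD eq_vecI index_zero_vec)
  then have "(\<Sum>i<N. (cmod (u $ i))\<^sup>2) > 0"
    by (intro sum_pos2[of _ i]) auto
  then have "n \<noteq> 0" "cnj n = n"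
    unfolding n of_real_eq_0_iff complex_cnj_complex_of_real by auto
  then show ?thesis
    using q cq by simp
qed

text \<open>
  Compare both sides of \<open>A u = k u\<close> in a coordinate where \<open>u\<close> is largest.
\<close>

lemma eigenvalue_norm_le:
  fixes A :: "complex mat"
  assumes A: "A \<in> carrier_mat N N"
    and B: "\<And>i j. i < N \<Longrightarrow> j < N \<Longrightarrow> cmod (A $$ (i, j)) \<le> B"
    and "eigenvalue A k"
  shows "cmod k \<le> of_nat N * B"
proof -
  obtain u where u: "u \<in> carrier_vec N" "u \<noteq> 0\<^sub>v N" "A *\<^sub>v u = k \<cdot>\<^sub>v u"
    using assms unfolding eigenvalue_def eigenvector_def by auto
  have Au: "(\<Sum>j<N. A $$ (i, j) * u $ j) = k * u $ i" if "i < N" for i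
    using arg_cong[OF u(3), of "\<lambda>w. w $ i"] that A u(1)
    by (simp add: scalar_prod_def atLeast0LessThan)
  obtain i0 where i0: "i0 < N" "u $ i0 \<noteq> 0"
    using u(1,2) by (metis carrier_vecD eq_vecI index_zero_vec)
  define c where "c = Max ((\<lambda>i. cmod (u $ i)) ` {..<N})"
  have c: "cmod (u $ j) \<le> c" if "j < N" for j
    unfolding c_def using that by (intro Max_ge) auto
  have "c \<in> (\<lambda>i. cmod (u $ i)) ` {..<N}"
    unfolding c_def using i0 by (intro Max_in) auto
  then obtain i where i: "i < N" "c = cmod (u $ i)"
    by auto
  have "c > 0"
    using c[OF i0(1)] i0(2) by (meson less_le_trans zero_less_norm_iff)
  have "cmod k * c = cmod (\<Sum>j<N. A $$ (i, j) * u $ j)"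
    unfolding Au[OF i(1)] i(2) norm_mult ..
  also have "\<dots> \<le> (\<Sum>j<N. cmod (A $$ (i, j)) * cmod (u $ j))"
    using norm_sum[of "\<lambda>j. A $$ (i, j) * u $ j"] by (simp add: norm_mult)
  also have "\<dots> \<le> (\<Sum>j<N. B * c)"
    using B[OF i(1)] c \<open>c > 0\<close>
    by (intro sum_mono mult_mono) (auto intro: order_trans[OF norm_ge_zero])
  finally have "cmod k * c \<le> (of_nat N * B) * c"
    by simp
  then show ?thesis
    using \<open>c > 0\<close> by simp
qed

text \<open>
  The eigenvalues are listed with the positive ones first. With this order the number of positive
  eigenvalues is visible in the list as the position \<open>p\<close>, and weak inequalities for the entries before and
  after \<open>p\<close> survive a passage to the limit. The values beyond \<open>N\<close> are set to \<open>0\<close> in order to have a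
  bounded sequence.
\<close>

lemma hermitian_char_poly:
  assumes A: "A \<in> carrier_mat N N"
    and herm: "\<And>i j. i < N \<Longrightarrow> j < N \<Longrightarrow> cnj (A $$ (j, i)) = A $$ (i, j)"
  obtains p and l :: "nat \<Rightarrow> real" where "p \<le> N"
    and "char_poly A = (\<Prod>i<N. [:- complex_of_real (l i), 1:])"
    and "\<forall>i<p. l i > 0" and "\<forall>i\<ge>p. l i \<le> 0"
    and "\<forall>i<N. eigenvalue A (complex_of_real (l i))"
    and "\<forall>i\<ge>N. l i = 0"
proof -
  obtain as where as: "char_poly A = (\<Prod>a\<leftarrow>as. [:- a, 1:])" "length as = N"
    using char_poly_factorized[OF A] by blast
  have ev: "eigenvalue A a" if "a \<in> set as" for a
    unfolding eigenvalue_root_char_poly[OF A] as(1) using that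
    by (auto simp: poly_prod_list prod_list_zero_iff)
  have real: "complex_of_real (Re a) = a" if "a \<in> set as" for a
    using hermitian_eigenvalue_real[OF A herm ev[OF that]] by (simp add: complex_eq_iff)
  define rs where "rs = map Re as"
  define ls where "ls = filter (\<lambda>r. r > 0) rs @ filter (\<lambda>r. \<not> r > 0) rs"
  define p where "p = length (filter (\<lambda>r. r > 0) rs)"
  define l where "l i = (if i < N then ls ! i else 0)" for i
  have mset: "mset ls = mset rs"
    unfolding ls_def mset_append mset_filter by simp
  have len: "length ls = N"
    using mset_eq_length[OF mset] as(2) by (simp add: rs_def)
  have "map (\<lambda>r. [:- complex_of_real r, 1:]) rs = map (\<lambda>a. [:- a, 1:]) as"
    unfolding rs_def using real by simp
  then have "char_poly A = prod_list (map (\<lambda>r. [:- complex_of_real r, 1:]) rs)"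
    unfolding as(1) by simp
  also have "\<dots> = prod_mset (mset (map (\<lambda>r. [:- complex_of_real r, 1:]) rs))"
    by (rule prod_mset_prod_list[symmetric])
  also have "\<dots> = prod_mset (mset (map (\<lambda>r. [:- complex_of_real r, 1:]) ls))"
    using mset by simp
  also have "\<dots> = prod_list (map (\<lambda>r. [:- complex_of_real r, 1:]) ls)"
    by (rule prod_mset_prod_list)
  also have "\<dots> = (\<Prod>i<N. [:- complex_of_real (l i), 1:])"
    unfolding prod.list_conv_set_nth using len by (simp add: l_def atLeast0LessThan)
  finally have char: "char_poly A = (\<Prod>i<N. [:- complex_of_real (l i), 1:])" .
  have "p \<le> N"
    unfolding len[symmetric] by (simp add: p_def ls_def)
  moreover have "l i > 0" if "i < p" for i
  proof -
    have "l i = filter (\<lambda>r. r > 0) rs ! i"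
      using that \<open>p \<le> N\<close> by (simp add: l_def ls_def p_def nth_append)
    moreover have "filter (\<lambda>r. r > 0) rs ! i \<in> set (filter (\<lambda>r. r > 0) rs)"
      using that by (intro nth_mem) (simp add: p_def)
    ultimately show ?thesis
      by auto
  qed
  moreover have "l i \<le> 0" if "p \<le> i" for i
  proof (cases "i < N")
    case True
    then have "l i = filter (\<lambda>r. \<not> r > 0) rs ! (i - p)"
      using that by (simp add: l_def ls_def p_def nth_append)
    moreover have "filter (\<lambda>r. \<not> r > 0) rs ! (i - p) \<in> set (filter (\<lambda>r. \<not> r > 0) rs)"
      using that True len by (intro nth_mem) (simp add: p_def ls_def)
    ultimately show ?thesis
      by (simp only: set_filter) auto
  qed (simp add: l_def)
  moreover have "eigenvalue A (complex_of_real (l i))" if "i < N" for i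
  proof -
    have "l i \<in> set ls"
      using that len by (simp add: l_def)
    then have "l i \<in> set rs"
      using mset mset_eq_setD by blast
    then show ?thesis
      using ev real by (auto simp: rs_def)
  qed
  moreover have "l i = 0" if "N \<le> i" for i
    using that by (simp add: l_def)
  ultimately show ?thesis
    using that char by blast
qed

lemma hermitian_signature_sum:
  assumes A: "A \<in> carrier_mat N N"
    and herm: "\<And>i j. i < N \<Longrightarrow> j < N \<Longrightarrow> cnj (A $$ (j, i)) = A $$ (i, j)"
    and "\<not> eigenvalue A 0"
  shows "fst (mat_signature A) + snd (mat_signature A) = N"
proof -
  obtain l p where l: "char_poly A = (\<Prod>i<N. [:- complex_of_real (l i), 1:])"
    "\<And>i. i < N \<Longrightarrow> eigenvalue A (complex_of_real (l i))"
    using hermitian_char_poly[OF A herm] by metis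
  have nz: "l i \<noteq> 0" if "i < N" for i
    using l(2)[OF that] assms(3) by auto
  have "card ({i. i < N \<and> l i > 0} \<union> {i. i < N \<and> l i < 0}) = card {i. i < N \<and> l i > 0} + card {i. i < N \<and> l i < 0}"
    by (rule card_Un_disjoint) auto
  moreover have "{i. i < N \<and> l i > 0} \<union> {i. i < N \<and> l i < 0} = {..<N}"
    using nz by (auto simp: linorder_neq_iff)
  ultimately show ?thesis
    unfolding mat_signature_char_poly[OF A l(1)] by simp
qed

lemma continuous_on_char_poly:
  assumes "\<And>t. t \<in> T \<Longrightarrow> g t \<in> carrier_mat N N"
    and "\<And>i j. i < N \<Longrightarrow> j < N \<Longrightarrow> continuous_on T (\<lambda>t. g t $$ (i, j))"
  shows "continuous_on T (\<lambda>t. poly (char_poly (g t :: complex mat)) z)"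
proof -
  have "continuous_on T (\<lambda>t. det (- (char_matrix (g t) z)))"
  proof (rule continuous_on_det)
    show "- char_matrix (g t) z \<in> carrier_mat N N" if "t \<in> T" for t
      using assms(1)[OF that] by simp
    show "continuous_on T (\<lambda>t. (- char_matrix (g t) z) $$ (i, j))" if "i < N" "j < N" for i j
    proof -
      have "continuous_on T (\<lambda>t. - (g t $$ (i, j) - (if i = j then z else 0)))"
        by (intro continuous_intros assms(2) that)
      moreover have "(- char_matrix (g t) z) $$ (i, j) = - (g t $$ (i, j) - (if i = j then z else 0))"
        if "t \<in> T" for t
        using assms(1)[OF that] \<open>i < N\<close> \<open>j < N\<close> by (auto simp: char_matrix_def)
      ultimately show ?thesis
        by (simp cong: continuous_on_cong)
    qed
  qed
  then show ?thesis
    using char_poly_matrix[OF assms(1)] by (simp cong: continuous_on_cong)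
qed

text \<open>
  The cube \<open>[-C, C]\<^sup>\<nat>\<close> is compact and metrizable, hence sequentially compact. Regarding a list as a sequence
  padded with zeros brings the lists of every length into this one space.
\<close>

lemma convergent_subsequence_coordinates:
  fixes L :: "nat \<Rightarrow> nat \<Rightarrow> real"
  assumes "\<And>n i. \<bar>L n i\<bar> \<le> C"
  obtains r l where "strict_mono r" "\<forall>i. (\<lambda>n. L (r n) i) \<longlonglongrightarrow> l i"
proof -
  have "compactin (product_topology (\<lambda>_. euclidean) UNIV) (PiE UNIV (\<lambda>_ :: nat. {-C..C}))"
    unfolding compactin_PiE by simp
  then have "compact (PiE UNIV (\<lambda>_ :: nat. {-C..C}))"
    by (simp add: euclidean_product_topology)
  then have "seq_compact (PiE UNIV (\<lambda>_ :: nat. {-C..C}))"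
    by (rule compact_imp_seq_compact)
  moreover have "L n \<in> PiE UNIV (\<lambda>_. {-C..C})" for n
    using assms[of n] by (auto simp: abs_le_iff minus_le_iff)
  ultimately obtain l r where "strict_mono r" and l: "(L \<circ> r) \<longlonglongrightarrow> l"
    unfolding seq_compact_def by meson
  moreover have "(\<lambda>n. L (r n) i) \<longlonglongrightarrow> l i" for i
    using continuous_on_tendsto_compose[OF continuous_on_product_coordinates[of i] l]
    by (simp add: o_def)
  ultimately show ?thesis
    using that by blast
qed

text \<open>
  The times at which there are exactly \<open>k\<close> positive eigenvalues form a closed set: for a convergent
  sequence of such times the ordered eigenvalue lists are bounded, a subsequence of them converges, and the
  limit list factors the characteristic polynomial of the limit matrix. The first \<open>k\<close> limits are \<open>\<ge> 0\<close>, the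
  others \<open>\<le> 0\<close>, and \<open>0\<close> is excluded. The finitely many closed sets obtained for \<open>k \<le> N\<close> partition the
  interval, which is connected, so only one of them is nonempty.
\<close>

lemma mat_signature_constant_on_path:
  assumes c: "\<And>t. t \<in> {0..1} \<Longrightarrow> g t \<in> carrier_mat N N"
    and herm: "\<And>t i j. t \<in> {0..1} \<Longrightarrow> i < N \<Longrightarrow> j < N \<Longrightarrow> cnj (g t $$ (j, i)) = g t $$ (i, j)"
    and nz: "\<And>t. t \<in> {0..1} \<Longrightarrow> \<not> eigenvalue (g t) 0"
    and cont: "\<And>i j. i < N \<Longrightarrow> j < N \<Longrightarrow> continuous_on {0..1 :: real} (\<lambda>t. g t $$ (i, j))"
  shows "mat_signature (g 0) = mat_signature (g 1)"
proof -
  define f where "f t = fst (mat_signature (g t))" for t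
  define T where "T k = {t \<in> {0..1}. f t = k}" for k
  have sum: "f t + snd (mat_signature (g t)) = N" if "t \<in> {0..1}" for t
    unfolding f_def by (rule hermitian_signature_sum[OF c[OF that] herm[OF that] nz[OF that]])
  obtain B where B: "\<And>t i j. t \<in> {0..1} \<Longrightarrow> i < N \<Longrightarrow> j < N \<Longrightarrow> cmod (g t $$ (i, j)) \<le> B"
  proof -
    let ?h = "\<lambda>t. \<Sum>i<N. \<Sum>j<N. cmod (g t $$ (i, j))"
    have "continuous_on {0..1} ?h"
      by (intro continuous_intros cont) auto
    then have "bounded (?h ` {0..1})"
      by (intro compact_imp_bounded compact_continuous_image) auto
    then obtain B where "\<forall>y\<in>?h ` {0..1}. norm y \<le> B"
      unfolding bounded_iff by blast
    then have B: "\<bar>?h t\<bar> \<le> B" if "t \<in> {0..1}" for t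
      using that by (simp del: atLeastAtMost_iff)
    have "cmod (g t $$ (i, j)) \<le> B" if "t \<in> {0..1}" "i < N" "j < N" for t i j
    proof -
      have "cmod (g t $$ (i, j)) \<le> (\<Sum>j<N. cmod (g t $$ (i, j)))"
        using that by (intro member_le_sum) auto
      also have "\<dots> \<le> ?h t"
        using that by (intro member_le_sum[of i _ "\<lambda>i. \<Sum>j<N. cmod (g t $$ (i, j))"]) (auto intro: sum_nonneg)
      also have "\<dots> \<le> B"
        using B[OF that(1)] by linarith
      finally show ?thesis .
    qed
    then show ?thesis
      using that by blast
  qed
  have closed: "closed (T k)" for k
    unfolding closed_sequential_limits
  proof (intro allI impI, elim conjE)
    fix s t
    assume s: "\<forall>n. s n \<in> T k" and lim: "s \<longlonglongrightarrow> t"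
    have s01: "s n \<in> {0..1}" and sk: "f (s n) = k" for n
      using s by (auto simp: T_def)
    have t01: "t \<in> {0..1}"
      using closed_sequentially[OF closed_atLeastAtMost s01 lim] .
    have "\<forall>n. \<exists>l. char_poly (g (s n)) = (\<Prod>i<N. [:- complex_of_real (l i), 1:]) \<and>
        (\<forall>i<k. l i > 0) \<and> (\<forall>i\<ge>k. l i \<le> 0) \<and> (\<forall>i. \<bar>l i\<bar> \<le> \<bar>of_nat N * B\<bar>)"
    proof
      fix n
      obtain p l where l: "p \<le> N" "char_poly (g (s n)) = (\<Prod>i<N. [:- complex_of_real (l i), 1:])"
        "\<forall>i<p. l i > 0" "\<forall>i\<ge>p. l i \<le> 0"
        "\<forall>i<N. eigenvalue (g (s n)) (complex_of_real (l i))" "\<forall>i\<ge>N. l i = 0"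
        by (rule hermitian_char_poly[OF c[OF s01[of n]] herm[OF s01[of n]]])
      have pos: "l i > 0 \<longleftrightarrow> i < p" for i
        using l(3)[rule_format, of i] l(4)[rule_format, of i] by (cases "i < p") auto
      have "{i. i < N \<and> l i > 0} = {i. i < N \<and> i < p}"
        by (simp only: pos)
      also have "\<dots> = {..<p}"
        using l(1) by auto
      finally have "card {i. i < N \<and> l i > 0} = p"
        by simp
      then have "p = k"
        using sk[of n] unfolding f_def mat_signature_char_poly[OF c[OF s01[of n]] l(2)] by simp
      moreover have "\<bar>l i\<bar> \<le> \<bar>of_nat N * B\<bar>" for i
      proof (cases "i < N")
        case True
        have "cmod (complex_of_real (l i)) \<le> of_nat N * B"
          by (rule eigenvalue_norm_le[OF c[OF s01[of n]] B[OF s01[of n]] l(5)[rule_format, OF True]])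
        then show ?thesis
          by simp
      qed (use l(6) in simp)
      ultimately show "\<exists>l. char_poly (g (s n)) = (\<Prod>i<N. [:- complex_of_real (l i), 1:]) \<and>
        (\<forall>i<k. l i > 0) \<and> (\<forall>i\<ge>k. l i \<le> 0) \<and> (\<forall>i. \<bar>l i\<bar> \<le> \<bar>of_nat N * B\<bar>)"
        using l(2-4) by (intro exI[of _ l]) simp
    qed
    from choice[OF this] obtain L where L: "\<And>n. char_poly (g (s n)) = (\<Prod>i<N. [:- complex_of_real (L n i), 1:])"
      "\<And>n i. i < k \<Longrightarrow> L n i > 0" "\<And>n i. k \<le> i \<Longrightarrow> L n i \<le> 0" "\<And>n i. \<bar>L n i\<bar> \<le> \<bar>of_nat N * B\<bar>"
      by blast
    obtain r l where r: "strict_mono r" and "\<forall>i. (\<lambda>n. L (r n) i) \<longlonglongrightarrow> l i"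
      by (rule convergent_subsequence_coordinates[OF L(4)])
    then have l: "(\<lambda>n. L (r n) i) \<longlonglongrightarrow> l i" for i
      by blast
    have cp: "continuous_on {0..1} (\<lambda>t. poly (char_poly (g t)) z)" for z
      by (rule continuous_on_char_poly) (use c cont in auto)
    have "poly (char_poly (g t)) z = poly (\<Prod>i<N. [:- complex_of_real (l i), 1:]) z" for z
    proof (rule LIMSEQ_unique)
      have "(\<lambda>n. poly (char_poly (g (s n))) z) \<longlonglongrightarrow> poly (char_poly (g t)) z"
        by (rule continuous_on_tendsto_compose[OF cp lim t01]) (use s01 in simp)
      then show "(\<lambda>n. poly (char_poly (g (s (r n)))) z) \<longlonglongrightarrow> poly (char_poly (g t)) z"
        using LIMSEQ_subseq_LIMSEQ[OF _ r, of "\<lambda>n. poly (char_poly (g (s n))) z"] by (simp add: o_def)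
      show "(\<lambda>n. poly (char_poly (g (s (r n)))) z) \<longlonglongrightarrow> poly (\<Prod>i<N. [:- complex_of_real (l i), 1:]) z"
        unfolding L(1) poly_prod by (simp, intro tendsto_intros l)
    qed
    then have char: "char_poly (g t) = (\<Prod>i<N. [:- complex_of_real (l i), 1:])"
      using poly_eq_poly_eq_iff by blast
    have "k \<le> N"
      using sum[OF s01[of 0]] sk[of 0] by linarith
    have lnz: "l i \<noteq> 0" if "i < N" for i
    proof
      assume "l i = 0"
      then have "poly (char_poly (g t)) 0 = 0"
        unfolding char using that by (auto simp: poly_prod)
      then show False
        using nz[OF t01] eigenvalue_root_char_poly[OF c[OF t01]] by blast
    qed
    have pos: "l i \<ge> 0" if "i < k" for i
      by (rule LIMSEQ_le_const[OF l]) (use L(2)[OF that] in \<open>auto intro: less_imp_le\<close>)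
    have neg: "l i \<le> 0" if "k \<le> i" for i
      by (rule LIMSEQ_le_const2[OF l]) (use L(3)[OF that] in auto)
    have sgn: "l i > 0 \<longleftrightarrow> i < k" if "i < N" for i
      using pos[of i] neg[of i] lnz[OF that] by (cases "i < k") auto
    have "{i. i < N \<and> l i > 0} = {i. i < N \<and> i < k}"
      by (intro Collect_cong conj_cong refl sgn)
    also have "\<dots> = {..<k}"
      using \<open>k \<le> N\<close> by auto
    finally have "card {i. i < N \<and> l i > 0} = k"
      by simp
    then show "t \<in> T k"
      using t01 mat_signature_char_poly[OF c[OF t01] char] by (simp add: T_def f_def)
  qed
  have "f 0 = f 1"
  proof (rule ccontr)
    assume ne: "f 0 \<noteq> f 1"
    let ?V = "\<Union>k\<in>{..N} - {f 0}. T k"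
    have closedV: "closed ?V"
      using closed by (intro closed_UN) auto
    have cover: "{0..1} \<subseteq> T (f 0) \<union> ?V"
    proof
      fix t :: real assume t: "t \<in> {0..1}"
      then have "f t \<le> N"
        using sum[OF t] by linarith
      then show "t \<in> T (f 0) \<union> ?V"
        using t by (auto simp: T_def)
    qed
    have disjoint: "T (f 0) \<inter> ?V \<inter> {0..1} = {}"
      by (auto simp: T_def)
    have "T (f 0) \<inter> {0..1} = {} \<or> ?V \<inter> {0..1} = {}"
      by (rule connected_closedD[OF connected_Icc disjoint cover closed closedV])
    moreover have "0 \<in> T (f 0) \<inter> {0..1}"
      by (simp add: T_def)
    moreover have "1 \<in> ?V \<inter> {0..1}"
      using ne sum[of 1] by (auto simp: T_def)
    ultimately show False
      by blast
  qed
  moreover have "snd (mat_signature (g 0)) = snd (mat_signature (g 1))"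
    using sum[of 0] sum[of 1] \<open>f 0 = f 1\<close> by simp
  ultimately show ?thesis
    by (simp add: f_def prod_eq_iff)
qed

section \<open>Signatures of principal submatrices\<close>

lemma bij_betw_pick:
  assumes "finite I"
  shows "bij_betw (pick I) {..<card I} I"
  unfolding bij_betw_def
proof
  show "inj_on (pick I) {..<card I}"
    by (rule inj_onI) (metis card_pick_le lessThan_iff)
  show "pick I ` {..<card I} = I"
  proof (intro equalityI subsetI)
    fix k assume "k \<in> I"
    then have "card {a \<in> I. a < k} < card I"
      using assms by (intro psubset_card_mono) auto
    then show "k \<in> pick I ` {..<card I}"
      using pick_card_in_set[OF \<open>k \<in> I\<close>]
      by (intro image_eqI[of _ _ "card {a \<in> I. a < k}"]) auto
  next
    fix k assume "k \<in> pick I ` {..<card I}"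
    then show "k \<in> I"
      using pick_in_set_le by auto
  qed
qed

lemma principal_submatrix:
  assumes x: "x \<in> carrier_mat N N" and I: "I \<subseteq> {..<N}"
  shows "submatrix x I I \<in> carrier_mat (card I) (card I)"
    and "\<And>i j. i < card I \<Longrightarrow> j < card I \<Longrightarrow> submatrix x I I $$ (i, j) = x $$ (pick I i, pick I j)"
proof -
  have "{i. i < N \<and> i \<in> I} = I"
    using I by auto
  then have card: "card {i. i < dim_row x \<and> i \<in> I} = card I" "card {i. i < dim_col x \<and> i \<in> I} = card I"
    using x by auto
  then show "submatrix x I I \<in> carrier_mat (card I) (card I)"
    by (auto simp: dim_submatrix)
  show "submatrix x I I $$ (i, j) = x $$ (pick I i, pick I j)" if "i < card I" "j < card I" for i j
    using that submatrix_index[of i x I j I] unfolding card by blast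
qed

text \<open>
  A null vector of the block extended by zero is a null vector of the whole matrix, because no edge
  enters \<open>I\<close> from outside.
\<close>

lemma not_eigenvalue_0_submatrix:
  assumes x: "x \<in> pattern_herm N E" and I: "I \<subseteq> {..<N}"
    and closed: "\<And>i j. i < N \<Longrightarrow> j \<in> I \<Longrightarrow> (i, j) \<in> E \<Longrightarrow> i \<in> I"
  shows "\<not> eigenvalue (submatrix x I I) 0"
proof
  assume "eigenvalue (submatrix x I I) 0"
  have xc: "x \<in> carrier_mat N N" and dx: "det x \<noteq> 0"
    and pat: "\<And>i j. i < N \<Longrightarrow> j < N \<Longrightarrow> (i, j) \<notin> E \<Longrightarrow> x $$ (i, j) = 0"
    using x unfolding pattern_herm_iff by auto
  note sub = principal_submatrix[OF xc I]
  have fin: "finite I"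
    using I finite_subset by blast
  obtain u where u: "u \<in> carrier_vec (card I)" "u \<noteq> 0\<^sub>v (card I)"
    and su: "submatrix x I I *\<^sub>v u = 0 \<cdot>\<^sub>v u"
    using \<open>eigenvalue _ 0\<close> sub(1) unfolding eigenvalue_def eigenvector_def by auto
  have xu: "(\<Sum>b<card I. x $$ (pick I a, pick I b) * u $ b) = 0" if "a < card I" for a
    using arg_cong[OF su, of "\<lambda>w. w $ a"] that sub u(1)
    by (simp add: scalar_prod_def atLeast0LessThan)
  define w where "w = vec N (\<lambda>k. if k \<in> I then u $ card {a \<in> I. a < k} else 0)"
  have w: "w $ pick I b = u $ b" if "b < card I" for b
    using pick_in_set_le[OF that] card_pick_le[OF that] I by (auto simp: w_def)
  have "x *\<^sub>v w = 0\<^sub>v N"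
  proof (rule eq_vecI)
    fix k assume "k < dim_vec (0\<^sub>v N)"
    then have k: "k < N"
      by simp
    have "(x *\<^sub>v w) $ k = (\<Sum>j<N. x $$ (k, j) * w $ j)"
      using k xc by (simp add: w_def scalar_prod_def atLeast0LessThan)
    also have "\<dots> = (\<Sum>j\<in>I. x $$ (k, j) * w $ j)"
      using I by (intro sum.mono_neutral_right) (auto simp: w_def)
    also have "\<dots> = (\<Sum>b<card I. x $$ (k, pick I b) * w $ pick I b)"
      by (rule sum.reindex_bij_betw[OF bij_betw_pick[OF fin], symmetric])
    also have "\<dots> = (\<Sum>b<card I. x $$ (k, pick I b) * u $ b)"
      by (intro sum.cong refl) (simp add: w)
    also have "\<dots> = 0"
    proof (cases "k \<in> I")
      case True
      then obtain a where "a < card I" "k = pick I a"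
        using bij_betw_pick[OF fin] unfolding bij_betw_def by (metis image_iff lessThan_iff)
      then show ?thesis
        using xu by simp
    next
      case False
      have "x $$ (k, pick I b) = 0" if "b < card I" for b
      proof (rule pat[OF k])
        show "pick I b < N"
          using pick_in_set_le[OF that] I by blast
        show "(k, pick I b) \<notin> E"
          using closed[OF k pick_in_set_le[OF that]] False by blast
      qed
      then show ?thesis
        by simp
    qed
    finally show "(x *\<^sub>v w) $ k = 0\<^sub>v N $ k"
      using k by simp
  qed (use xc in simp)
  moreover have "w \<noteq> 0\<^sub>v N"
  proof
    assume "w = 0\<^sub>v N"
    then have "u $ b = 0" if "b < card I" for b
      using w[OF that] pick_in_set_le[OF that] I by (simp add: subset_iff)
    then have "u = 0\<^sub>v (card I)"
      using u(1) by (intro eq_vecI) auto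
    then show False
      using u(2) by simp
  qed
  moreover have "w \<in> carrier_vec N"
    by (simp add: w_def)
  ultimately have "det x = 0"
    using det_0_iff_vec_prod_zero_field[OF xc] by blast
  then show False
    using dx by simp
qed

lemma submatrix_hermitian:
  assumes x: "x \<in> pattern_herm N E" and I: "I \<subseteq> {..<N}" and "i < card I" "j < card I"
  shows "cnj (submatrix x I I $$ (j, i)) = submatrix x I I $$ (i, j)"
proof -
  have xc: "x \<in> carrier_mat N N" and herm: "\<And>i j. i < N \<Longrightarrow> j < N \<Longrightarrow> cnj (x $$ (j, i)) = x $$ (i, j)"
    using x unfolding pattern_herm_iff by auto
  have "pick I i < N" "pick I j < N"
    using pick_in_set_le assms(3,4) I by blast+
  then show ?thesis
    using herm principal_submatrix(2)[OF xc I] assms(3,4) by simp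
qed

lemma submatrix_signature_sum:
  assumes x: "x \<in> pattern_herm N E" and I: "I \<subseteq> {..<N}"
    and closed: "\<And>i j. i < N \<Longrightarrow> j \<in> I \<Longrightarrow> (i, j) \<in> E \<Longrightarrow> i \<in> I"
  shows "fst (mat_signature (submatrix x I I)) + snd (mat_signature (submatrix x I I)) = card I"
proof (rule hermitian_signature_sum)
  show "submatrix x I I \<in> carrier_mat (card I) (card I)"
    using principal_submatrix(1)[OF _ I] x pattern_herm_carrier by blast
  show "\<not> eigenvalue (submatrix x I I) 0"
    by (rule not_eigenvalue_0_submatrix[OF x I closed])
qed (rule submatrix_hermitian[OF x I])

lemma submatrix_signature_joined:
  assumes xy: "joined N (pattern_herm N E) x y" and I: "I \<subseteq> {..<N}"
    and closed: "\<And>i j. i < N \<Longrightarrow> j \<in> I \<Longrightarrow> (i, j) \<in> E \<Longrightarrow> i \<in> I"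
  shows "mat_signature (submatrix x I I) = mat_signature (submatrix y I I)"
proof -
  obtain g where g: "g 0 = x" "g 1 = y"
    and gP: "\<And>t. t \<in> {0..1} \<Longrightarrow> g t \<in> pattern_herm N E"
    and cont: "\<And>i j. i < N \<Longrightarrow> j < N \<Longrightarrow> continuous_on {0..1 :: real} (\<lambda>t. g t $$ (i, j))"
    using xy unfolding joined_iff_path[OF pattern_herm_carrier] by auto
  have gc: "g t \<in> carrier_mat N N" if "t \<in> {0..1}" for t
    using gP[OF that] pattern_herm_carrier by blast
  have "mat_signature (submatrix (g 0) I I) = mat_signature (submatrix (g 1) I I)"
  proof (rule mat_signature_constant_on_path)
    fix t :: real assume t: "t \<in> {0..1}"
    show "submatrix (g t) I I \<in> carrier_mat (card I) (card I)"
      by (rule principal_submatrix(1)[OF gc[OF t] I])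
    show "\<not> eigenvalue (submatrix (g t) I I) 0"
      by (rule not_eigenvalue_0_submatrix[OF gP[OF t] I closed])
    fix i j assume "i < card I" "j < card I"
    then show "cnj (submatrix (g t) I I $$ (j, i)) = submatrix (g t) I I $$ (i, j)"
      by (rule submatrix_hermitian[OF gP[OF t] I])
  next
    fix i j assume ij: "i < card I" "j < card I"
    have "pick I i < N" "pick I j < N"
      using pick_in_set_le ij I by blast+
    then have "continuous_on {0..1} (\<lambda>t. g t $$ (pick I i, pick I j))"
      by (rule cont)
    then show "continuous_on {0..1} (\<lambda>t. submatrix (g t) I I $$ (i, j))"
      by (rule continuous_on_eq) (use principal_submatrix(2)[OF gc I ij] in simp)
  qed
  then show ?thesis
    unfolding g .
qed

lemma submatrix_signature_diag_sign:
  assumes I: "I \<subseteq> {..<N}"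
  shows "mat_signature (submatrix (diag_sign N d) I I) = (card {i \<in> I. d i}, card {i \<in> I. \<not> d i})"
proof -
  have fin: "finite I"
    using I finite_subset by blast
  define l :: "nat \<Rightarrow> real" where "l i = (if d (pick I i) then 1 else -1)" for i
  have dc: "diag_sign N d \<in> carrier_mat N N"
    by (simp add: diag_sign_def)
  note sub = principal_submatrix[OF dc I]
  have pick: "pick I i < N" if "i < card I" for i
    using pick_in_set_le[OF that] I by blast
  have inj: "pick I i = pick I j \<longleftrightarrow> i = j" if "i < card I" "j < card I" for i j
    using that inj_on_eq_iff[OF bij_betw_imp_inj_on[OF bij_betw_pick[OF fin]]] by simp
  have entry: "submatrix (diag_sign N d) I I $$ (i, j) = (if i = j then complex_of_real (l i) else 0)"
    if "i < card I" "j < card I" for i j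
    using pick[OF that(1)] pick[OF that(2)] inj[OF that] sub(2)[OF that]
    by (simp add: diag_sign_def l_def)
  have "upper_triangular (submatrix (diag_sign N d) I I)"
    using sub(1) entry by (auto simp: upper_triangular_def)
  then have "char_poly (submatrix (diag_sign N d) I I)
      = (\<Prod>a\<leftarrow>diag_mat (submatrix (diag_sign N d) I I). [:- a, 1:])"
    by (rule char_poly_upper_triangular[OF sub(1)])
  also have "\<dots> = (\<Prod>i<card I. [:- complex_of_real (l i), 1:])"
    using sub(1) entry by (simp add: diag_mat_def prod.list_conv_set_nth atLeast0LessThan)
  finally have char: "char_poly (submatrix (diag_sign N d) I I)
      = (\<Prod>i<card I. [:- complex_of_real (l i), 1:])" .
  have count: "card {i. i < card I \<and> Q (pick I i)} = card {i \<in> I. Q i}" for Q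
  proof (rule bij_betw_same_card[of "pick I"])
    show "bij_betw (pick I) {i. i < card I \<and> Q (pick I i)} {i \<in> I. Q i}"
      using bij_betw_Collect[OF bij_betw_pick[OF fin], of Q "\<lambda>i. Q (pick I i)"] by simp
  qed
  have "l i > 0 \<longleftrightarrow> d (pick I i)" "l i < 0 \<longleftrightarrow> \<not> d (pick I i)" for i
    by (simp_all add: l_def)
  then show ?thesis
    unfolding mat_signature_char_poly[OF sub(1) char]
    using count[of d] count[of "\<lambda>i. \<not> d i"] by (simp only:)
qed

section \<open>The components of the space of invertible hermitian elements\<close>

text \<open>
  An initial piece of a path, reparametrized to the unit interval, is again a path with the same
  starting point; so a path never leaves a set that contains everything reachable from its start.
\<close>

lemma joined_within:
  assumes xy: "joined N H x y" and H: "H \<subseteq> carrier_mat N N" and "S \<subseteq> H"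
    and S: "\<And>z. joined N H x z \<Longrightarrow> z \<in> S"
  shows "joined N S x y"
proof -
  obtain g where g: "g 0 = x" "g 1 = y"
    and gH: "\<And>t. t \<in> {0..1} \<Longrightarrow> g t \<in> H"
    and cont: "\<And>i j. i < N \<Longrightarrow> j < N \<Longrightarrow> continuous_on {0..1 :: real} (\<lambda>t. g t $$ (i, j))"
    using xy unfolding joined_iff_path[OF H] by auto
  have "joined N S (g 0) (g 1)"
  proof (rule joined_by_path[OF _ _ cont])
    show "S \<subseteq> carrier_mat N N"
      using assms by blast
    fix t :: real assume t: "0 \<le> t" "t \<le> 1"
    have scale: "s * t \<in> {0..1}" if "0 \<le> s" "s \<le> 1" for s
      using that t by (simp add: mult_le_one)
    have "joined N H (g (0 * t)) (g (1 * t))"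
    proof (rule joined_by_path[OF H])
      fix i j assume "i < N" "j < N"
      then show "continuous_on {0..1} (\<lambda>s. g (s * t) $$ (i, j))"
        by (intro continuous_on_compose2[OF cont]) (use scale in \<open>auto intro!: continuous_intros\<close>)
    qed (use gH scale in blast)
    then show "g t \<in> S"
      using S g by simp
  qed
  then show ?thesis
    unfolding g .
qed

text \<open>
  Both matrices are first joined to sign matrices. The signature of a block of a sign matrix is its
  number of positive and negative signs, and it is inherited from the original matrix.
\<close>

lemma joined_if_submatrix_signatures:
  assumes refl: "\<And>i. i < N \<Longrightarrow> (i, i) \<in> E" and sym: "sym E" and sub: "E \<subseteq> {..<N} \<times> {..<N}"
    and x: "x \<in> pattern_herm N E" and y: "y \<in> pattern_herm N E"
    and sig: "\<And>v I. v < N \<Longrightarrow> I = {j. j < N \<and> (v, j) \<in> E\<^sup>*} \<Longrightarrow>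
        mat_signature (submatrix x I I) = mat_signature (submatrix y I I)"
  shows "joined N (pattern_herm N E) x y"
proof -
  obtain d where d: "joined N (pattern_herm N E) x (diag_sign N d)"
    using joined_diag_sign[OF x refl] by blast
  obtain d' where d': "joined N (pattern_herm N E) y (diag_sign N d')"
    using joined_diag_sign[OF y refl] by blast
  have "joined N (pattern_herm N E) (diag_sign N d) (diag_sign N d')"
  proof (rule joined_diag_sign_same_counts[OF refl sym sub])
    fix v assume v: "v < N"
    define I where "I = {j. j < N \<and> (v, j) \<in> E\<^sup>*}"
    have I: "I \<subseteq> {..<N}"
      by (auto simp: I_def)
    have closed: "i \<in> I" if "i < N" "j \<in> I" "(i, j) \<in> E" for i j
      using that sym unfolding I_def by (auto dest: symD intro: rtrancl_into_rtrancl)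
    have "mat_signature (submatrix (diag_sign N d) I I) = mat_signature (submatrix x I I)"
      by (rule submatrix_signature_joined[OF d I closed, symmetric])
    also have "\<dots> = mat_signature (submatrix y I I)"
      by (rule sig[OF v I_def])
    also have "\<dots> = mat_signature (submatrix (diag_sign N d') I I)"
      by (rule submatrix_signature_joined[OF d' I closed])
    finally have "card {i \<in> I. d i} = card {i \<in> I. d' i}"
      unfolding submatrix_signature_diag_sign[OF I] by simp
    then show "card {j \<in> {j. j < N \<and> (v, j) \<in> E\<^sup>*}. d j} = card {j \<in> {j. j < N \<and> (v, j) \<in> E\<^sup>*}. d' j}"
      unfolding I_def .
  qed
  then show ?thesis
    by (rule path_component_of_trans[OF path_component_of_trans[OF d] joined_sym[OF d']])
qed

lemma path_components_bij_invariant: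
  assumes S: "S \<subseteq> carrier_mat N N"
    and f: "\<And>x y. x \<in> S \<Longrightarrow> y \<in> S \<Longrightarrow> joined N S x y \<longleftrightarrow> f x = f y"
    and T: "f ` S = T"
  shows "\<exists>\<phi>. (\<forall>C\<in>path_components_of (subtopology (mat_topology N) S). \<forall>x\<in>C. \<phi> C = f x) \<and>
    bij_betw \<phi> (path_components_of (subtopology (mat_topology N) S)) T"
proof -
  have comps: "path_components_of (subtopology (mat_topology N) S) = (\<lambda>x. {y \<in> S. f x = f y}) ` S"
  proof -
    have "Collect (joined N S x) = {y \<in> S. f x = f y}" if "x \<in> S" for x
      using f[OF that] joined_in by blast
    moreover have "topspace (subtopology (mat_topology N) S) = S"
      using S by (auto simp: topspace_mat_topology)
    ultimately show ?thesis
      unfolding path_components_of_def by (metis (no_types, lifting) image_cong)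
  qed
  define \<phi> where "\<phi> C = f (SOME x. x \<in> C)" for C
  have \<phi>: "\<phi> {y \<in> S. f x = f y} = f x" if "x \<in> S" for x
  proof -
    have "(SOME z. z \<in> {y \<in> S. f x = f y}) \<in> {y \<in> S. f x = f y}"
      by (rule someI[of _ x]) (use that in simp)
    then show ?thesis
      unfolding \<phi>_def by simp
  qed
  show ?thesis
    unfolding comps
  proof (intro exI[of _ \<phi>] conjI)
    show "\<forall>C\<in>(\<lambda>x. {y \<in> S. f x = f y}) ` S. \<forall>x\<in>C. \<phi> C = f x"
      using \<phi> by simp
    show "bij_betw \<phi> ((\<lambda>x. {y \<in> S. f x = f y}) ` S) T"
    proof (rule bij_betw_imageI)
      show "inj_on \<phi> ((\<lambda>x. {y \<in> S. f x = f y}) ` S)"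
        by (rule inj_onI) (use \<phi> in auto)
      show "\<phi> ` (\<lambda>x. {y \<in> S. f x = f y}) ` S = T"
        unfolding image_image T[symmetric] by (rule image_cong) (use \<phi> in simp_all)
    qed
  qed
qed

section \<open>Graph operator systems\<close>

text \<open>
  The graph with vertices \<open>(i, a)\<close>, encoded as \<open>a * n + (i - 1)\<close>; \<open>k mod n + 1\<close> recovers \<open>i\<close> from the
  index \<open>k\<close>.
\<close>

definition amp_edges :: "nat \<Rightarrow> nat \<Rightarrow> (nat \<times> nat) set \<Rightarrow> (nat \<times> nat) set" where
  "amp_edges n m R = {(i, j). i < n * m \<and> j < n * m \<and> (i mod n + 1, j mod n + 1) \<in> R}"

definition amp_indices :: "nat \<Rightarrow> nat \<Rightarrow> nat set \<Rightarrow> nat set" where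
  "amp_indices n m K = {k. k < n * m \<and> k mod n + 1 \<in> K}"

lemma amp_index_less:
  assumes "a < m" "i < n"
  shows "a * n + i < n * (m :: nat)"
proof -
  have "a * n + i < Suc a * n"
    using assms by simp
  also have "\<dots> \<le> m * n"
    using assms by (intro mult_le_mono1) simp
  finally show ?thesis
    by (simp add: mult.commute)
qed

lemma pick_interval: "i < n \<Longrightarrow> pick {c..<c + n} i = c + i"
proof -
  assume "i < n"
  then have "{a \<in> {c..<c + n}. a < c + i} = {c..<c + i}"
    by auto
  then show ?thesis
    using pick_card_in_set[of "c + i" "{c..<c + n}"] \<open>i < n\<close> by simp
qed

lemma block_in_graph_opsys:
  assumes x: "x \<in> carrier_mat (n * m) (n * m)" and ab: "a < m" "b < m"
  shows "submatrix x {a * n..<a * n + n} {b * n..<b * n + n} \<in> graph_opsys n R \<longleftrightarrow>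
    (\<forall>i<n. \<forall>j<n. (i + 1, j + 1) \<notin> R \<longrightarrow> x $$ (a * n + i, b * n + j) = 0)"
proof -
  have "{i. i < n * m \<and> i \<in> {c * n..<c * n + n}} = {c * n..<c * n + n}" if "c < m" for c
    using amp_index_less[of c m "n - 1" n] that by (cases n) auto
  then have card: "card {i. i < dim_row x \<and> i \<in> {a * n..<a * n + n}} = n"
    "card {i. i < dim_col x \<and> i \<in> {b * n..<b * n + n}} = n"
    using x ab by auto
  have "submatrix x {a * n..<a * n + n} {b * n..<b * n + n} $$ (i, j) = x $$ (a * n + i, b * n + j)"
    if "i < n" "j < n" for i j
    using submatrix_index[of i x "{a * n..<a * n + n}" j "{b * n..<b * n + n}"] that pick_interval
    unfolding card by simp
  moreover have "submatrix x {a * n..<a * n + n} {b * n..<b * n + n} \<in> carrier_mat n n"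
    using card by (auto simp: dim_submatrix)
  moreover have "(\<forall>i\<in>{1..n}. Q i) \<longleftrightarrow> (\<forall>i<n. Q (i + 1))" for Q
    by (metis Suc_eq_plus1 Suc_le_eq atLeastAtMost_iff le_add2 le_add_diff_inverse2)
  ultimately show ?thesis
    unfolding graph_opsys_def by simp
qed

text \<open>
  This removes the amplification: the block conditions together describe the support in one graph.
\<close>

lemma herm_inv_eq_pattern_herm:
  assumes "n \<ge> 1"
  shows "herm_inv n m (graph_opsys n R) = pattern_herm (n * m) (amp_edges n m R)"
proof -
  have "(\<forall>a<m. \<forall>b<m. submatrix x {a * n..<a * n + n} {b * n..<b * n + n} \<in> graph_opsys n R) \<longleftrightarrow>
      (\<forall>k<n * m. \<forall>l<n * m. (k, l) \<notin> amp_edges n m R \<longrightarrow> x $$ (k, l) = 0)"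
    (is "?L \<longleftrightarrow> ?R") if x: "x \<in> carrier_mat (n * m) (n * m)" for x
  proof
    assume L: ?L
    show ?R
    proof (intro allI impI)
      fix k l assume kl: "k < n * m" "l < n * m" "(k, l) \<notin> amp_edges n m R"
      have "k div n < m" "l div n < m" "k mod n < n" "l mod n < n"
        using kl assms by (auto simp: less_mult_imp_div_less mult.commute)
      moreover have "(k mod n + 1, l mod n + 1) \<notin> R"
        using kl by (simp add: amp_edges_def)
      ultimately have "x $$ (k div n * n + k mod n, l div n * n + l mod n) = 0"
        using L block_in_graph_opsys[OF x] by blast
      then show "x $$ (k, l) = 0"
        by simp
    qed
  next
    assume R: ?R
    show ?L
    proof (intro allI impI)
      fix a b assume ab: "a < m" "b < m"
      have "x $$ (a * n + i, b * n + j) = 0" if ij: "i < n" "j < n" "(i + 1, j + 1) \<notin> R" for i j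
      proof -
        have "(a * n + i, b * n + j) \<notin> amp_edges n m R"
          using ij by (simp add: amp_edges_def)
        then show ?thesis
          using R amp_index_less[OF ab(1) ij(1)] amp_index_less[OF ab(2) ij(2)] by blast
      qed
      then show "submatrix x {a * n..<a * n + n} {b * n..<b * n + n} \<in> graph_opsys n R"
        using block_in_graph_opsys[OF x ab] by blast
    qed
  qed
  then show ?thesis
    unfolding herm_inv_def mat_amp_def pattern_herm_def by blast
qed

lemma amp_indices_eq:
  assumes "n \<ge> 1" and K: "K \<subseteq> {1..n}"
  shows "amp_indices n m K = (\<lambda>(a, i). a * n + (i - 1)) ` ({..<m} \<times> K)"
proof (intro equalityI subsetI)
  fix k assume "k \<in> amp_indices n m K"
  then have "k < n * m" "k mod n + 1 \<in> K"
    by (auto simp: amp_indices_def)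
  then show "k \<in> (\<lambda>(a, i). a * n + (i - 1)) ` ({..<m} \<times> K)"
    by (intro image_eqI[of _ _ "(k div n, k mod n + 1)"])
      (auto simp: less_mult_imp_div_less mult.commute)
next
  fix k assume "k \<in> (\<lambda>(a, i). a * n + (i - 1)) ` ({..<m} \<times> K)"
  then obtain a i where ai: "a < m" "i \<in> K" "k = a * n + (i - 1)"
    by auto
  have "i \<in> {1..n}"
    using K ai(2) by blast
  then obtain i' where "i = Suc i'" "i' < n"
    by (cases i) auto
  then show "k \<in> amp_indices n m K"
    using ai amp_index_less[of a m i' n] by (simp add: amp_indices_def)
qed

lemma card_amp_indices:
  assumes "n \<ge> 1" and K: "K \<subseteq> {1..n}"
  shows "card (amp_indices n m K) = card K * m"
proof -
  have "inj_on (\<lambda>(a, i). a * n + (i - 1)) ({..<m} \<times> K)"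
  proof (rule inj_onI, clarify)
    fix a i b j assume *: "i \<in> K" "j \<in> K" "a * n + (i - 1) = b * n + (j - 1)"
    have "i \<in> {1..n}" "j \<in> {1..n}"
      using K *(1,2) by blast+
    then obtain i' j' where ij: "i = Suc i'" "j = Suc j'" "i' < n" "j' < n"
      by (cases i; cases j) auto
    have eq: "a * n + i' = b * n + j'"
      using *(3) ij by simp
    show "a = b \<and> i = j"
      using arg_cong[OF eq, of "\<lambda>k. k div n"] arg_cong[OF eq, of "\<lambda>k. k mod n"] ij by simp
  qed
  then show ?thesis
    unfolding amp_indices_eq[OF assms] by (simp add: card_image card_cartesian_product mult.commute)
qed

lemma summand_eq_submatrix:
  assumes "n \<ge> 1" and "K \<subseteq> {1..n}"
  shows "summand n m K x = submatrix x (amp_indices n m K) (amp_indices n m K)"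
proof -
  have "{a * n + (i - 1) | a i. a < m \<and> i \<in> K} = amp_indices n m K"
    unfolding amp_indices_eq[OF assms] by auto
  then show ?thesis
    unfolding summand_def Let_def by simp
qed

lemma tolerance_rel_rtrancl_in:
  assumes "tolerance_rel X R" "(i, j) \<in> R\<^sup>*" "i \<in> X"
  shows "j \<in> X"
  using assms(2,3) by (induction rule: rtrancl_induct) (use assms(1) in \<open>auto simp: tolerance_rel_def\<close>)

text \<open>
  Reflexivity and symmetry hold already for \<open>R\<close>, so only transitivity remains to be generated.
\<close>

lemma generated_equiv_rtrancl:
  assumes R: "tolerance_rel X R"
  shows "generated_equiv X R = {(i, j). i \<in> X \<and> (i, j) \<in> R\<^sup>*}" (is "_ = ?S")
proof
  have "sym (R\<^sup>*)"
    using R by (simp add: tolerance_rel_def sym_rtrancl)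
  then have "sym ?S"
    using tolerance_rel_rtrancl_in[OF R] by (auto intro!: symI dest: symD)
  moreover have "refl_on X ?S" "?S \<subseteq> X \<times> X"
    using tolerance_rel_rtrancl_in[OF R] by (auto simp: refl_on_def)
  moreover have "trans ?S"
    by (rule transI) auto
  ultimately have "equiv X ?S"
    by (simp add: equiv_def)
  moreover have "R \<subseteq> ?S"
    using R by (auto simp: tolerance_rel_def)
  ultimately show "generated_equiv X R \<subseteq> ?S"
    unfolding generated_equiv_def by blast
next
  show "?S \<subseteq> generated_equiv X R"
    unfolding generated_equiv_def
  proof clarify
    fix i j S assume "i \<in> X" "(i, j) \<in> R\<^sup>*" "equiv X S" "R \<subseteq> S"
    then show "(i, j) \<in> S"
      by (induction rule: rtrancl_induct[OF \<open>(i, j) \<in> R\<^sup>*\<close>])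
        (auto simp: equiv_def refl_on_def dest: transD)
  qed
qed

lemma equiv_generated_equiv: "equiv X (generated_equiv X R)" if R: "tolerance_rel X R"
proof -
  have "sym (R\<^sup>*)"
    using R by (simp add: tolerance_rel_def sym_rtrancl)
  then show ?thesis
    unfolding generated_equiv_rtrancl[OF R] equiv_def
    using tolerance_rel_rtrancl_in[OF R] by (auto simp: refl_on_def intro!: symI transI dest: symD)
qed

text \<open>
  Walks in the large graph project to walks in \<open>R\<close>. Conversely, a walk in \<open>R\<close> is lifted to block \<open>0\<close>,
  except for its ends. The loops in \<open>R\<close> make this possible for walks of length \<open>0\<close> too: they join the copies
  of the same vertex in different blocks.
\<close>

lemma rtrancl_amp_edges:
  assumes n: "n \<ge> 1" and R: "tolerance_rel {1..n} R" and i: "i < n * m" and j: "j < n * m"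
  shows "(i, j) \<in> (amp_edges n m R)\<^sup>* \<longleftrightarrow> (i mod n + 1, j mod n + 1) \<in> R\<^sup>*"
proof
  assume "(i, j) \<in> (amp_edges n m R)\<^sup>*"
  then show "(i mod n + 1, j mod n + 1) \<in> R\<^sup>*"
  proof (induction rule: rtrancl_induct)
    case (step k l)
    then show ?case
      by (auto simp: amp_edges_def intro: rtrancl_into_rtrancl)
  qed simp
next
  have "(i mod n + 1, w) \<in> R\<^sup>* \<Longrightarrow> \<forall>j<n * m. j mod n + 1 = w \<longrightarrow> (i, j) \<in> (amp_edges n m R)\<^sup>*" for w
  proof (induction rule: rtrancl_induct)
    case base
    have "(i mod n + 1, i mod n + 1) \<in> R"
      using R n by (auto simp: tolerance_rel_def refl_on_def Suc_le_eq)
    then show ?case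
      using i by (auto simp: amp_edges_def intro!: r_into_rtrancl)
  next
    case (step u w)
    have u: "u \<ge> 1" "u \<le> n"
      using step.hyps(2) R by (auto simp: tolerance_rel_def)
    have "u - 1 < n"
      using u by simp
    moreover have "n \<le> n * m"
      using i by (cases m) auto
    ultimately have u1: "u - 1 < n * m" "(u - 1) mod n + 1 = u"
      using u by (linarith, simp)
    then have reach: "(i, u - 1) \<in> (amp_edges n m R)\<^sup>*"
      using step.IH by blast
    have edge: "(u - 1, j) \<in> amp_edges n m R" if "j < n * m" "j mod n + 1 = w" for j
      using that u1 step.hyps(2) by (simp add: amp_edges_def)
    show ?case
      by (intro allI impI rtrancl_into_rtrancl[OF reach edge])
  qed
  then show "(i mod n + 1, j mod n + 1) \<in> R\<^sup>* \<Longrightarrow> (i, j) \<in> (amp_edges n m R)\<^sup>*"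
    using j by blast
qed

lemma amp_edges_refl:
  assumes "n \<ge> 1" "tolerance_rel {1..n} R" "i < n * m"
  shows "(i, i) \<in> amp_edges n m R"
  using assms by (auto simp: amp_edges_def tolerance_rel_def refl_on_def Suc_le_eq)

lemma amp_edges_sym: "tolerance_rel X R \<Longrightarrow> sym (amp_edges n m R)"
  by (auto simp: amp_edges_def tolerance_rel_def intro!: symI dest: symD)

lemma amp_edges_subset: "amp_edges n m R \<subseteq> {..<n * m} \<times> {..<n * m}"
  by (auto simp: amp_edges_def)

lemma card_pairs_with_sum: "card {(p, q). p + q = (M :: nat)} = M + 1"
proof -
  have "{(p, q). p + q = M} = (\<lambda>p. (p, M - p)) ` {..M}"
    by auto
  then show ?thesis
    by (simp add: card_image inj_on_def)
qed

text \<open>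
  For invertible matrices of a given size the sum \<open>p + q\<close> is fixed, so \<open>p - q\<close> determines the signature.
\<close>

lemma signature_label_inj:
  assumes "fst s + snd s = fst s' + snd s'" "signature_label s = signature_label s'"
  shows "s = s'"
  using assms by (auto simp: signature_label_def prod_eq_iff)

lemma rel_component:
  assumes R: "tolerance_rel {1..n} R" and K: "K \<in> rel_components {1..n} R"
  shows "K \<subseteq> {1..n}" "\<And>i. i \<in> K \<Longrightarrow> K = {j. (i, j) \<in> R\<^sup>*}"
proof -
  note equiv = equiv_generated_equiv[OF R]
  show sub: "K \<subseteq> {1..n}"
    using K equiv unfolding rel_components_def by (metis Union_quotient Union_upper)
  fix i assume "i \<in> K"
  then have "i \<in> {1..n}"
    using sub by blast
  obtain a where a: "K = generated_equiv {1..n} R `` {a}"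
    using K unfolding rel_components_def by (rule quotientE)
  then have "(a, i) \<in> generated_equiv {1..n} R"
    using \<open>i \<in> K\<close> by simp
  then have "K = generated_equiv {1..n} R `` {i}"
    unfolding a by (rule equiv_class_eq[OF equiv])
  then show "K = {j. (i, j) \<in> R\<^sup>*}"
    using \<open>i \<in> {1..n}\<close> unfolding generated_equiv_rtrancl[OF R] by auto
qed

lemma rel_component_exists:
  assumes R: "tolerance_rel {1..n} R" and i: "i \<in> {1..n}"
  shows "{j. (i, j) \<in> R\<^sup>*} \<in> rel_components {1..n} R"
proof -
  have "generated_equiv {1..n} R `` {i} \<in> rel_components {1..n} R"
    unfolding rel_components_def using i by (rule quotientI)
  then show ?thesis
    using i unfolding generated_equiv_rtrancl[OF R] by (simp add: Image_def)
qed

lemma amp_indices_closed: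
  assumes R: "tolerance_rel {1..n} R" and K: "K \<in> rel_components {1..n} R"
    and "i < n * m" "j \<in> amp_indices n m K" "(i, j) \<in> amp_edges n m R"
  shows "i \<in> amp_indices n m K"
proof -
  have "(j mod n + 1, i mod n + 1) \<in> R" "j mod n + 1 \<in> K"
    using assms(4,5) R by (auto simp: amp_edges_def amp_indices_def tolerance_rel_def dest: symD)
  then have "i mod n + 1 \<in> K"
    using rel_component(2)[OF R K] by blast
  then show ?thesis
    using assms(3) by (simp add: amp_indices_def)
qed

lemma amp_indices_subset: "amp_indices n m K \<subseteq> {..<n * m}"
  by (auto simp: amp_indices_def)

lemma summand_signature_sum:
  assumes n: "n \<ge> 1" and R: "tolerance_rel {1..n} R" and K: "K \<in> rel_components {1..n} R"
    and x: "x \<in> pattern_herm (n * m) (amp_edges n m R)"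
  shows "fst (mat_signature (summand n m K x)) + snd (mat_signature (summand n m K x)) = card K * m"
  unfolding summand_eq_submatrix[OF n rel_component(1)[OF R K]]
    card_amp_indices[OF n rel_component(1)[OF R K], symmetric]
  by (rule submatrix_signature_sum[OF x amp_indices_subset amp_indices_closed[OF R K]])

lemma signature_tuple_joined_iff:
  assumes n: "n \<ge> 1" and R: "tolerance_rel {1..n} R"
    and x: "x \<in> pattern_herm (n * m) (amp_edges n m R)"
    and y: "y \<in> pattern_herm (n * m) (amp_edges n m R)"
  shows "joined (n * m) (pattern_herm (n * m) (amp_edges n m R)) x y \<longleftrightarrow>
    signature_tuple n m R x = signature_tuple n m R y"
proof
  assume xy: "joined (n * m) (pattern_herm (n * m) (amp_edges n m R)) x y"
  show "signature_tuple n m R x = signature_tuple n m R y"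
    unfolding signature_tuple_def
  proof (rule restrict_ext)
    fix K assume K: "K \<in> rel_components {1..n} R"
    show "mat_signature (summand n m K x) = mat_signature (summand n m K y)"
      unfolding summand_eq_submatrix[OF n rel_component(1)[OF R K]]
      by (rule submatrix_signature_joined[OF xy amp_indices_subset amp_indices_closed[OF R K]])
  qed
next
  assume eq: "signature_tuple n m R x = signature_tuple n m R y"
  show "joined (n * m) (pattern_herm (n * m) (amp_edges n m R)) x y"
  proof (rule joined_if_submatrix_signatures[OF amp_edges_refl[OF n R] amp_edges_sym[OF R]
        amp_edges_subset x y])
    fix v I assume v: "v < n * m" and I: "I = {j. j < n * m \<and> (v, j) \<in> (amp_edges n m R)\<^sup>*}"
    define K where "K = {j. (v mod n + 1, j) \<in> R\<^sup>*}"
    have "v mod n + 1 \<in> {1..n}"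
      using n by (simp add: Suc_le_eq)
    then have K: "K \<in> rel_components {1..n} R"
      unfolding K_def by (rule rel_component_exists[OF R])
    have "amp_indices n m K = I"
      unfolding I using rtrancl_amp_edges[OF n R v] by (auto simp: amp_indices_def K_def)
    moreover have "mat_signature (summand n m K x) = mat_signature (summand n m K y)"
      using fun_cong[OF eq, of K] K by (simp add: signature_tuple_def)
    ultimately show "mat_signature (submatrix x I I) = mat_signature (submatrix y I I)"
      unfolding summand_eq_submatrix[OF n rel_component(1)[OF R K]] by simp
  qed
qed

text \<open>
  For surjectivity, choose in the index set of each component \<open>K\<close> as many places for the sign \<open>+1\<close> as
  the prescribed tuple demands, and take the diagonal matrix with these signs.
\<close>

lemma signature_tuple_image:
  assumes n: "n \<ge> 1" and R: "tolerance_rel {1..n} R"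
  shows "signature_tuple n m R ` pattern_herm (n * m) (amp_edges n m R) =
    (\<Pi>\<^sub>E K\<in>rel_components {1..n} R. {(p, q). p + q = card K * m})" (is "_ = ?T")
proof (intro equalityI subsetI)
  fix s assume "s \<in> signature_tuple n m R ` pattern_herm (n * m) (amp_edges n m R)"
  then obtain x where x: "x \<in> pattern_herm (n * m) (amp_edges n m R)" "s = signature_tuple n m R x"
    by blast
  show "s \<in> ?T"
    unfolding x(2) signature_tuple_def restrict_PiE_iff
  proof
    fix K assume "K \<in> rel_components {1..n} R"
    from summand_signature_sum[OF n R this x(1)]
    show "mat_signature (summand n m K x) \<in> {(p, q). p + q = card K * m}"
      by (simp add: case_prod_beta)
  qed
next
  fix s assume s: "s \<in> ?T"
  let ?\<K> = "rel_components {1..n} R"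
  have sK: "fst (s K) + snd (s K) = card (amp_indices n m K)" if "K \<in> ?\<K>" for K
    using PiE_mem[OF s that] card_amp_indices[OF n rel_component(1)[OF R that]] by auto
  have "\<exists>A. A \<subseteq> amp_indices n m K \<and> card A = fst (s K)" if "K \<in> ?\<K>" for K
    using obtain_subset_with_card_n[of "fst (s K)" "amp_indices n m K"] sK[OF that] by (metis le_add1)
  then obtain A where A: "\<And>K. K \<in> ?\<K> \<Longrightarrow> A K \<subseteq> amp_indices n m K" "\<And>K. K \<in> ?\<K> \<Longrightarrow> card (A K) = fst (s K)"
    by metis
  define d where "d i \<longleftrightarrow> (\<exists>K\<in>?\<K>. i \<in> A K)" for i
  have dK: "{i \<in> amp_indices n m K. d i} = A K" if K: "K \<in> ?\<K>" for K
  proof (intro equalityI subsetI)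
    fix i assume i: "i \<in> {i \<in> amp_indices n m K. d i}"
    then obtain L where L: "L \<in> ?\<K>" "i \<in> A L"
      by (auto simp: d_def)
    then have "i mod n + 1 \<in> L" "i mod n + 1 \<in> K"
      using A(1)[OF L(1)] i by (auto simp: amp_indices_def)
    then have "L = K"
      using rel_component(2)[OF R K] rel_component(2)[OF R L(1)] by metis
    then show "i \<in> A K"
      using L by simp
  qed (use A(1)[OF K] K in \<open>auto simp: d_def\<close>)
  have "signature_tuple n m R (diag_sign (n * m) d) = s"
  proof
    fix K
    show "signature_tuple n m R (diag_sign (n * m) d) K = s K"
    proof (cases "K \<in> ?\<K>")
      case True
      have fin: "finite (amp_indices n m K)"
        by (rule finite_subset[OF amp_indices_subset]) simp
      have "{i \<in> amp_indices n m K. \<not> d i} = amp_indices n m K - A K"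
        unfolding dK[OF True, symmetric] by blast
      then have "card {i \<in> amp_indices n m K. \<not> d i} = card (amp_indices n m K) - card (A K)"
        using card_Diff_subset[OF finite_subset[OF A(1)[OF True] fin] A(1)[OF True]] by (simp only:)
      then have "card {i \<in> amp_indices n m K. \<not> d i} = snd (s K)"
        using sK[OF True] A(2)[OF True] by linarith
      moreover have "card {i \<in> amp_indices n m K. d i} = fst (s K)"
        unfolding dK[OF True] by (rule A(2)[OF True])
      ultimately have "mat_signature (summand n m K (diag_sign (n * m) d)) = s K"
        unfolding summand_eq_submatrix[OF n rel_component(1)[OF R True]]
          submatrix_signature_diag_sign[OF amp_indices_subset] by (simp only: prod.collapse)
      then show ?thesis
        using True by (simp only: signature_tuple_def restrict_apply')
    next
      case False
      then show ?thesis
        using PiE_arb[OF s] by (simp add: signature_tuple_def)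
    qed
  qed
  moreover have "diag_sign (n * m) d \<in> pattern_herm (n * m) (amp_edges n m R)"
    by (rule diag_sign_in[OF amp_edges_refl[OF n R]])
  ultimately show "s \<in> signature_tuple n m R ` pattern_herm (n * m) (amp_edges n m R)"
    by blast
qed

lemma label_tuple_eq_iff:
  assumes n: "n \<ge> 1" and R: "tolerance_rel {1..n} R"
    and x: "x \<in> pattern_herm (n * m) (amp_edges n m R)"
    and y: "y \<in> pattern_herm (n * m) (amp_edges n m R)"
  shows "label_tuple n m R x = label_tuple n m R y \<longleftrightarrow> signature_tuple n m R x = signature_tuple n m R y"
proof
  assume eq: "label_tuple n m R x = label_tuple n m R y"
  show "signature_tuple n m R x = signature_tuple n m R y"
    unfolding signature_tuple_def
  proof (rule restrict_ext)
    fix K assume K: "K \<in> rel_components {1..n} R"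
    show "mat_signature (summand n m K x) = mat_signature (summand n m K y)"
    proof (rule signature_label_inj)
      show "signature_label (mat_signature (summand n m K x)) = signature_label (mat_signature (summand n m K y))"
        using fun_cong[OF eq, of K] K by (simp add: label_tuple_def)
    qed (simp add: summand_signature_sum[OF n R K x] summand_signature_sum[OF n R K y])
  qed
next
  assume eq: "signature_tuple n m R x = signature_tuple n m R y"
  show "label_tuple n m R x = label_tuple n m R y"
    unfolding label_tuple_def
  proof (rule restrict_ext)
    fix K assume K: "K \<in> rel_components {1..n} R"
    show "signature_label (mat_signature (summand n m K x)) = signature_label (mat_signature (summand n m K y))"
      using fun_cong[OF eq, of K] K by (simp add: signature_tuple_def)
  qed
qed

lemma label_tuple_image:
  assumes n: "n \<ge> 1" and R: "tolerance_rel {1..n} R"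
  shows "label_tuple n m R ` pattern_herm (n * m) (amp_edges n m R) =
    (\<Pi>\<^sub>E K\<in>rel_components {1..n} R. {- int (card K * m) + 2 * int k | k. k \<le> card K * m})" (is "_ = ?T")
proof (intro equalityI subsetI)
  fix s assume "s \<in> label_tuple n m R ` pattern_herm (n * m) (amp_edges n m R)"
  then obtain x where x: "x \<in> pattern_herm (n * m) (amp_edges n m R)" "s = label_tuple n m R x"
    by blast
  show "s \<in> ?T"
    unfolding x(2) label_tuple_def restrict_PiE_iff
  proof
    fix K assume "K \<in> rel_components {1..n} R"
    from summand_signature_sum[OF n R this x(1)]
    show "signature_label (mat_signature (summand n m K x)) \<in>
        {- int (card K * m) + 2 * int k | k. k \<le> card K * m}"
      by (intro CollectI exI[of _ "fst (mat_signature (summand n m K x))"])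
        (simp add: signature_label_def flip: of_nat_mult)
  qed
next
  fix s assume s: "s \<in> ?T"
  let ?\<K> = "rel_components {1..n} R"
  have "\<exists>k. s K = - int (card K * m) + 2 * int k \<and> k \<le> card K * m" if "K \<in> ?\<K>" for K
    using PiE_mem[OF s that] by blast
  then obtain k where k: "\<And>K. K \<in> ?\<K> \<Longrightarrow> s K = - int (card K * m) + 2 * int (k K)"
    "\<And>K. K \<in> ?\<K> \<Longrightarrow> k K \<le> card K * m"
    by metis
  have "(\<lambda>K\<in>?\<K>. (k K, card K * m - k K)) \<in> (\<Pi>\<^sub>E K\<in>?\<K>. {(p, q). p + q = card K * m})"
    using k(2) by auto
  then have "(\<lambda>K\<in>?\<K>. (k K, card K * m - k K)) \<in>
      signature_tuple n m R ` pattern_herm (n * m) (amp_edges n m R)"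
    unfolding signature_tuple_image[OF n R] .
  then obtain x where x: "(\<lambda>K\<in>?\<K>. (k K, card K * m - k K)) = signature_tuple n m R x"
    "x \<in> pattern_herm (n * m) (amp_edges n m R)"
    by (rule imageE)
  have "label_tuple n m R x = s"
  proof
    fix K
    show "label_tuple n m R x K = s K"
    proof (cases "K \<in> ?\<K>")
      case True
      then have "mat_signature (summand n m K x) = (k K, card K * m - k K)"
        using fun_cong[OF x(1), of K] by (simp add: signature_tuple_def)
      then show ?thesis
        using True k(1)[OF True] k(2)[OF True]
        by (simp add: label_tuple_def signature_label_def of_nat_diff del: of_nat_mult)
    next
      case False
      then show ?thesis
        using PiE_arb[OF s] by (simp add: label_tuple_def)
    qed
  qed
  then show "s \<in> label_tuple n m R ` pattern_herm (n * m) (amp_edges n m R)"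
    using x(2) by blast
qed

lemma submatrix_all: "x \<in> carrier_mat N N \<Longrightarrow> submatrix x {..<N} {..<N} = x"
proof (rule eq_matI)
  assume x: "x \<in> carrier_mat N N"
  note sub = principal_submatrix[OF x subset_refl]
  have pick: "pick {..<N} i = i" if "i < N" for i
  proof -
    have "{a \<in> {..<N}. a < i} = {..<i}"
      using that by auto
    then show ?thesis
      using pick_card_in_set[of i "{..<N}"] that by simp
  qed
  show "dim_row (submatrix x {..<N} {..<N}) = dim_row x" "dim_col (submatrix x {..<N} {..<N}) = dim_col x"
    using sub(1) x by auto
  show "submatrix x {..<N} {..<N} $$ (i, j) = x $$ (i, j)" if "i < dim_row x" "j < dim_col x" for i j
    using that x sub(2)[of i j] pick by simp
qed

text \<open>
  For connected \<open>R\<close> there is only one block, the matrix itself. Two matrices with the same signature are joined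
  by a path of invertible hermitian elements, and by invariance the signature is constant along this path.
\<close>

lemma path_connected_herm_inv_sig:
  assumes n: "n \<ge> 1" and R: "tolerance_rel {1..n} R" and conn: "connected_rel {1..n} R"
  shows "path_connected_space
    (subtopology (mat_topology (n * m)) (herm_inv_sig n m (graph_opsys n R) p q))"
proof -
  define N where "N = n * m"
  define E where "E = amp_edges n m R"
  define S where "S = herm_inv_sig n m (graph_opsys n R) p q"
  have S: "S = {x \<in> pattern_herm N E. mat_signature x = (p, q)}"
    unfolding S_def herm_inv_sig_def herm_inv_eq_pattern_herm[OF n] N_def E_def ..
  have all: "submatrix x {..<N} {..<N} = x" if "x \<in> pattern_herm N E" for x
    using that pattern_herm_carrier submatrix_all by blast
  have "joined N S x y" if x: "x \<in> S" and y: "y \<in> S" for x y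
  proof (rule joined_within[OF _ pattern_herm_carrier])
    show "S \<subseteq> pattern_herm N E"
      unfolding S by blast
    show "joined N (pattern_herm N E) x y"
      unfolding N_def E_def
    proof (rule joined_if_submatrix_signatures[OF amp_edges_refl[OF n R] amp_edges_sym[OF R] amp_edges_subset])
      show "x \<in> pattern_herm (n * m) (amp_edges n m R)" "y \<in> pattern_herm (n * m) (amp_edges n m R)"
        using x y unfolding S N_def E_def by simp_all
      fix v I assume v: "v < n * m" and I: "I = {j. j < n * m \<and> (v, j) \<in> (amp_edges n m R)\<^sup>*}"
      have "(v mod n + 1, j mod n + 1) \<in> R\<^sup>*" for j
        using conn n unfolding connected_rel_def by (simp add: Suc_le_eq)
      then have "I = {..<N}"
        unfolding I N_def using rtrancl_amp_edges[OF n R v] by auto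
      then show "mat_signature (submatrix x I I) = mat_signature (submatrix y I I)"
        using x y all unfolding S by simp
    qed
    fix z assume z: "joined N (pattern_herm N E) x z"
    then have "mat_signature (submatrix x {..<N} {..<N}) = mat_signature (submatrix z {..<N} {..<N})"
      by (rule submatrix_signature_joined) auto
    then show "z \<in> S"
      using x joined_in[OF z] all unfolding S by auto
  qed
  then show ?thesis
    unfolding path_connected_space_iff_path_component S_def N_def by auto
qed

theorem theorem5p1:
  fixes n m :: nat and R :: "(nat \<times> nat) set"
  assumes "n \<ge> 1" and "m \<ge> 1" and "tolerance_rel {1..n} R"
  shows "(connected_rel {1..n} R \<longrightarrow>
            (\<forall>p q. p + q = n * m \<longrightarrow>
              path_connected_space
                (subtopology (mat_topology (n * m)) (herm_inv_sig n m (graph_opsys n R) p q))))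
       \<and> card (V0 n m (graph_opsys n R)) = (\<Prod>K\<in>rel_components {1..n} R. card K * m + 1)
       \<and> (\<exists>\<phi>. (\<forall>C\<in>V0 n m (graph_opsys n R). \<forall>x\<in>C. \<phi> C = signature_tuple n m R x) \<and>
            bij_betw \<phi> (V0 n m (graph_opsys n R))
              (\<Pi>\<^sub>E K\<in>rel_components {1..n} R. {(p, q). p + q = card K * m}))
       \<and> (\<exists>\<psi>. (\<forall>C\<in>V0 n m (graph_opsys n R). \<forall>x\<in>C. \<psi> C = label_tuple n m R x) \<and>
            bij_betw \<psi> (V0 n m (graph_opsys n R))
              (\<Pi>\<^sub>E K\<in>rel_components {1..n} R. {- int (card K * m) + 2 * int k | k. k \<le> card K * m}))"
proof -
  note n = assms(1) and R = assms(3)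
  have V0: "V0 n m (graph_opsys n R) = path_components_of
      (subtopology (mat_topology (n * m)) (pattern_herm (n * m) (amp_edges n m R)))"
    unfolding V0_def herm_inv_eq_pattern_herm[OF n] ..
  have signature: "\<exists>\<phi>. (\<forall>C\<in>V0 n m (graph_opsys n R). \<forall>x\<in>C. \<phi> C = signature_tuple n m R x) \<and>
      bij_betw \<phi> (V0 n m (graph_opsys n R))
        (\<Pi>\<^sub>E K\<in>rel_components {1..n} R. {(p, q). p + q = card K * m})"
    unfolding V0 by (rule path_components_bij_invariant[OF pattern_herm_carrier
        signature_tuple_joined_iff[OF n R] signature_tuple_image[OF n R]])
  have label: "\<exists>\<psi>. (\<forall>C\<in>V0 n m (graph_opsys n R). \<forall>x\<in>C. \<psi> C = label_tuple n m R x) \<and>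
      bij_betw \<psi> (V0 n m (graph_opsys n R))
        (\<Pi>\<^sub>E K\<in>rel_components {1..n} R. {- int (card K * m) + 2 * int k | k. k \<le> card K * m})"
    unfolding V0
  proof (rule path_components_bij_invariant[OF pattern_herm_carrier _ label_tuple_image[OF n R]])
    fix x y assume xy: "x \<in> pattern_herm (n * m) (amp_edges n m R)" "y \<in> pattern_herm (n * m) (amp_edges n m R)"
    show "joined (n * m) (pattern_herm (n * m) (amp_edges n m R)) x y \<longleftrightarrow>
        label_tuple n m R x = label_tuple n m R y"
      unfolding signature_tuple_joined_iff[OF n R xy] label_tuple_eq_iff[OF n R xy] by (rule refl)
  qed
  have "finite (rel_components {1..n} R)"
    unfolding rel_components_def
    using equiv_generated_equiv[OF R] by (intro finite_quotient) (auto simp: equiv_def)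
  then have card_target: "card (\<Pi>\<^sub>E K\<in>rel_components {1..n} R. {(p, q). p + q = card K * m}) =
      (\<Prod>K\<in>rel_components {1..n} R. card K * m + 1)"
    by (simp only: card_PiE card_pairs_with_sum)
  obtain \<phi> where "bij_betw \<phi> (V0 n m (graph_opsys n R))
      (\<Pi>\<^sub>E K\<in>rel_components {1..n} R. {(p, q). p + q = card K * m})"
    using signature by (elim exE conjE)
  then have "card (V0 n m (graph_opsys n R)) = (\<Prod>K\<in>rel_components {1..n} R. card K * m + 1)"
    unfolding card_target[symmetric] by (rule bij_betw_same_card)
  with signature label show ?thesis
    by (intro conjI impI allI path_connected_herm_inv_sig[OF n R])
qed

end
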